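(* Let $\beta>0$ and let $h\in\mathcal{G}$ be a $\mathcal{C}^2$-diffeomorphism of $S^1$. Then the map $\tau_h:\mathcal{G}\to\mathcal{G}$, $g\mapsto h\circ g$, is bijective and leaves $\mathbb{Q}^\beta$ quasi-invariant: the push forward of $\mathbb{Q}^\beta$ under $\tau_h^{-1}=\tau_{h^{-1}}$ is absolutely continuous with respect to $\mathbb{Q}^\beta$ with density $$\frac{d(\tau_{h^{-1}})_*\mathbb{Q}^\beta}{d\mathbb{Q}^\beta}(g)=Y_h^\beta(g).$$ Moreover, the function $Y_h^\beta$ is bounded from above and from below away from $0$ on $\mathcal{G}$.
   Context: $S^1=\mathbb{R}/\mathbb{Z}$; for $x,y\in S^1$, $y-x$ denotes the length $|[x,y]|$ of the positively oriented arc from $x$ to $y$. $\mathcal{G}$ is the set of maps $g:S^1\to S^1$ induced by right continuous nondecreasing $\tilde g:\mathbb{R}\to\mathbb{R}$ with $\tilde g(x+1)=\tilde g(x)+1$ (a semigroup under composition). For $\beta>0$, $\mathbb{Q}^\beta$ is the probability measure on $\mathcal{G}$ such that for each ordered family $t_1,\dots,t_N\in S^1$ (i.e. $\sum_i|[t_i,t_{i+1}]|=1$, $t_{N+1}:=t_1$) the law of $(g(t_1),\dots,g(t_N))$ is $\frac{\Gamma(\beta)}{\prod_{i=1}^N\Gamma(\beta|[t_i,t_{i+1}]|)}\prod_{i=1}^N|[x_i,x_{i+1}]|^{\beta|[t_i,t_{i+1}]|-1}dx_1\cdots dx_N$ on $\{(x_i)\in(S^1)^N:\sum_i|[x_i,x_{i+1}]|=1\}$,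 $x_{N+1}:=x_1$. For $g,h\in\mathcal{G}$ with $h\in\mathcal{C}^2$ strictly increasing, let $J_g\subset S^1$ be the set of jump locations of $g$, $g(a\pm)$ the one-sided limits, $\frac{\delta(h\circ g)}{\delta g}(a):=\frac{h(g(a+))-h(g(a-))}{g(a+)-g(a-)}$, and $$Y_h^0(g):=\prod_{a\in J_g}\frac{\sqrt{h'(g(a-))\,h'(g(a+))}}{\frac{\delta(h\circ g)}{\delta g}(a)},\qquad X_h^\beta(g):=\exp\Big(\beta\int_0^1\log h'(g(s))\,ds\Big),\qquad Y_h^\beta:=X_h^\beta\cdot Y_h^0$$ (the infinite product converges for all such $g,h$). *)

theory Defs
  imports "HOL-Probability.Probability"
begin

text \<open>Points of S^1 = R/Z are represented by reals in [0,1); the projection is frac.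
  An element g of the semigroup G is represented by the 1-periodic function
  x |-> frac (gt x) : real => real, where gt is a lift.\<close>

definition is_lift :: "(real \<Rightarrow> real) \<Rightarrow> bool" where
  "is_lift gt \<longleftrightarrow> mono gt \<and> (\<forall>x. continuous (at_right x) gt) \<and> (\<forall>x. gt (x + 1) = gt x + 1)"

definition Gset :: "(real \<Rightarrow> real) set" where
  "Gset = {g. \<exists>gt. is_lift gt \<and> g = (\<lambda>x. frac (gt x))}"

text \<open>A chosen lift of a map in G (Y below does not depend on the choice).\<close>
definition lift_of :: "(real \<Rightarrow> real) \<Rightarrow> (real \<Rightarrow> real)" where
  "lift_of g = (SOME gt. is_lift gt \<and> g = (\<lambda>x. frac (gt x)))"

definition G_space :: "(real \<Rightarrow> real) measure" where
  "G_space = sigma Gset {{g \<in> Gset. g t \<in> B} | t B. B \<in> sets borel}"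

definition arc :: "real \<Rightarrow> real \<Rightarrow> real" where
  "arc x y = frac (y - x)"

definition dir_support :: "nat \<Rightarrow> (nat \<Rightarrow> real) set" where
  "dir_support N = {x \<in> PiE {..<N} (\<lambda>_. {0..<1}).
      (\<Sum>i<N. arc (x i) (x (Suc i mod N))) = 1}"

definition dir_density :: "real \<Rightarrow> nat \<Rightarrow> (nat \<Rightarrow> real) \<Rightarrow> (nat \<Rightarrow> real) \<Rightarrow> real" where
  "dir_density \<beta> N t x =
     Gamma \<beta> / (\<Prod>i<N. Gamma (\<beta> * arc (t i) (t (Suc i mod N))))
     * (\<Prod>i<N. arc (x i) (x (Suc i mod N)) powr (\<beta> * arc (t i) (t (Suc i mod N)) - 1))"

definition is_Qbeta :: "real \<Rightarrow> (real \<Rightarrow> real) measure \<Rightarrow> bool" where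
  "is_Qbeta \<beta> Q \<longleftrightarrow> prob_space Q \<and> sets Q = sets G_space \<and> space Q = Gset \<and>
     (\<forall>N t. (\<forall>i<N. t i \<in> {0..<1}) \<and> inj_on t {..<N}
            \<and> (\<Sum>i<N. arc (t i) (t (Suc i mod N))) = 1 \<longrightarrow>
        distr Q (PiM {..<N} (\<lambda>_. lborel)) (\<lambda>g. \<lambda>i\<in>{..<N}. g (t i))
        = density (PiM {..<N} (\<lambda>_. lborel))
            (\<lambda>x. indicator (dir_support N) x * ennreal (dir_density \<beta> N t x)))"

text \<open>Jump locations (in [0,1) = S^1) of a lift gt; g(a+) = gt a, g(a-) = left limit.\<close>
definition jumps :: "(real \<Rightarrow> real) \<Rightarrow> real set" where
  "jumps gt = {a \<in> {0..<1}. Lim (at_left a) gt < gt a}"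

definition Y0 :: "(real \<Rightarrow> real) \<Rightarrow> (real \<Rightarrow> real) \<Rightarrow> real" where
  "Y0 h g = (let ht = lift_of h; gt = lift_of g in
     exp (\<Sum>\<^sub>\<infinity>a\<in>jumps gt.
        ln (sqrt (deriv ht (Lim (at_left a) gt) * deriv ht (gt a))
            / ((ht (gt a) - ht (Lim (at_left a) gt)) / (gt a - Lim (at_left a) gt)))))"

definition Xb :: "real \<Rightarrow> (real \<Rightarrow> real) \<Rightarrow> (real \<Rightarrow> real) \<Rightarrow> real" where
  "Xb \<beta> h g = exp (\<beta> * integral {0..1} (\<lambda>s. ln (deriv (lift_of h) (g s))))"

definition Yb :: "real \<Rightarrow> (real \<Rightarrow> real) \<Rightarrow> (real \<Rightarrow> real) \<Rightarrow> real" where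
  "Yb \<beta> h g = Xb \<beta> h g * Y0 h g"

end

theory Submission
  imports Defs
begin

text \<open>
  On the dyadic grid of level n the law of the values of g has an explicit density, so the change
  of variables x |-> h(x) in each coordinate shows that the push-forward has, on the sigma-algebra
  generated by these values, a density that is a product over the grid intervals of
  slope to the power beta/2^n times sqrt(h'(x) h'(y)) / slope, where slope is the difference quotient
  of h over the increment [x, y] of g. The logarithm q(x, y) of the second factor is bounded by a
  multiple of y - x and is o(y - x), so these densities are uniformly bounded. As n grows the powers
  converge to X by dominated convergence in time. For the other factors one writes the sum of
  the q(x, y) as the integral, over the range of the lift of g, of the step function
  q(x, y) / (y - x): its limit vanishes at points where g is continuous, and is constant on the gap of
  each jump, so the sum converges to the logarithm of Y0. Bounded convergence identifies the two
  measures on dyadic cylinders, which form a generator stable under intersection.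
\<close>

text \<open>The shape of the factors comes from the exponents. Each arc enters the marginal density
  with exponent beta/2^n - 1, and the substitution multiplies the arc by the slope of h. The share
  beta/2^n is the length of a grid interval and produces a Riemann-type sum in time. The share -1
  and the Jacobian, the product of h' at the grid points, have in general no limit separately. They
  balance once h' at each grid point is split evenly, one square root to either adjacent interval.
  This symmetric split cancels the first-order term of q, which a one-sided split would leave behind
  as an additional contribution of the continuous part of g. With h' merely C^1 the remainder is o(y
  - x) and no better rate is available. The obstacle is that g may have infinitely many, even dense
  jumps, so that a grid interval mixes a jump with other growth. Integrating over the range removes
  any need to separate large jumps from small ones: a Lipschitz constant of ln h' dominates all the
  step functions at once. The convergence holds for every g and not only almost surely, so bounds at
  finite level pass to the limit on the whole space.\<close>

subsection \<open>Step functions on partitions of an interval\<close>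

lemma partition_index:
  fixes p :: "nat \<Rightarrow> real"
  assumes "p 0 \<le> y" "y < p N"
  obtains i where "i < N" "p i \<le> y" "y < p (Suc i)"
proof -
  have "\<exists>i<N. p i \<le> y \<and> y < p (Suc i)"
    using assms
  proof (induction N)
    case (Suc N)
    then show ?case by (cases "y < p N") (auto simp: less_Suc_eq)
  qed simp
  then show ?thesis using that by blast
qed

lemma partition_mono:
  fixes p :: "nat \<Rightarrow> real"
  assumes "\<And>i. i < N \<Longrightarrow> p i \<le> p (Suc i)" "i \<le> j" "j \<le> N"
  shows "p i \<le> p j"
  using assms(2,3)
proof (induction j rule: dec_induct)
  case (step n)
  then show ?case using assms(1)[of n] by simp
qed simp

definition step_fun :: "(nat \<Rightarrow> real) \<Rightarrow> (nat \<Rightarrow> real) \<Rightarrow> nat \<Rightarrow> real \<Rightarrow> real" where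
  "step_fun p c N y = (\<Sum>i<N. indicator {p i..<p (Suc i)} y * c i)"

lemma step_fun_eq:
  assumes mono: "\<And>i. i < N \<Longrightarrow> p i \<le> p (Suc i)"
    and i: "i < N" "p i \<le> y" "y < p (Suc i)"
  shows "step_fun p c N y = c i"
proof -
  have "y \<notin> {p j..<p (Suc j)}" if "j < N" "j \<noteq> i" for j
  proof (cases "j < i")
    case True
    then have "p (Suc j) \<le> p i" using partition_mono[of N p "Suc j" i] mono i by simp
    then show ?thesis using i by auto
  next
    case False
    then have "p (Suc i) \<le> p j" using partition_mono[of N p "Suc i" j] mono that by simp
    then show ?thesis using i by auto
  qed
  then have "step_fun p c N y = (\<Sum>j<N. if j = i then c i else 0)"
    unfolding step_fun_def using i by (intro sum.cong) auto
  then show ?thesis using i by simp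
qed

lemma step_fun_eq_0:
  assumes mono: "\<And>i. i < N \<Longrightarrow> p i \<le> p (Suc i)" and "y \<notin> {p 0..<p N}"
  shows "step_fun p c N y = 0"
proof -
  have "y \<notin> {p j..<p (Suc j)}" if "j < N" for j
    using partition_mono[of N p 0 j] partition_mono[of N p "Suc j" N] mono that assms(2) by auto
  then show ?thesis unfolding step_fun_def by (intro sum.neutral) auto
qed

lemma step_fun_measurable [measurable]: "step_fun p c N \<in> borel_measurable borel"
  unfolding step_fun_def by measurable

lemma integral_step_fun:
  assumes mono: "\<And>i. i < N \<Longrightarrow> p i \<le> p (Suc i)"
  shows "integral\<^sup>L lborel (step_fun p c N) = (\<Sum>i<N. c i * (p (Suc i) - p i))"
proof -
  have "integral\<^sup>L lborel (step_fun p c N)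
      = (\<Sum>i<N. \<integral>y. indicator {p i..<p (Suc i)} y * c i \<partial>lborel)"
    unfolding step_fun_def using mono by (intro Bochner_Integration.integral_sum integrable_mult_left) auto
  also have "\<dots> = (\<Sum>i<N. c i * (p (Suc i) - p i))"
    using mono by (intro sum.cong) (auto simp: mult.commute)
  finally show ?thesis .
qed

lemma step_fun_bounded:
  assumes mono: "\<And>i. i < N \<Longrightarrow> p i \<le> p (Suc i)" and C: "\<And>i. i < N \<Longrightarrow> \<bar>c i\<bar> \<le> C"
  shows "\<bar>step_fun p c N y\<bar> \<le> indicator {p 0..<p N} y * C"
proof (cases "y \<in> {p 0..<p N}")
  case True
  then obtain i where i: "i < N" "p i \<le> y" "y < p (Suc i)"
    using partition_index[of p y N] by auto
  then show ?thesis using True C[OF i(1)] step_fun_eq[OF mono i, where c = c] by simp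
next
  case False
  then show ?thesis using step_fun_eq_0[OF mono False, where c = c] by simp
qed

text \<open>Dominated convergence for the step functions with values \<open>c n i\<close>. The
  hypothesis on limits speaks of any index sequence \<open>I\<close> tracking \<open>y\<close>;
  monotonicity of \<open>p n\<close> leaves at most one. It is applied to partitions of time, given
  by the grid, and to partitions of the range, given by the values of a lift on the grid.\<close>

lemma step_sums_tendsto:
  fixes p c :: "nat \<Rightarrow> nat \<Rightarrow> real" and F :: "real \<Rightarrow> real"
  assumes mono: "\<And>n i. i < N n \<Longrightarrow> p n i \<le> p n (Suc i)"
    and ends: "\<And>n. p n 0 = a" "\<And>n. p n (N n) = b"
    and C: "\<And>n i. i < N n \<Longrightarrow> \<bar>c n i\<bar> \<le> C"
    and F [measurable]: "F \<in> borel_measurable borel"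
    and lim: "AE y in lborel. y \<in> {a..<b} \<longrightarrow>
      (\<forall>I. (\<forall>n. I n < N n \<and> p n (I n) \<le> y \<and> y < p n (Suc (I n))) \<longrightarrow> (\<lambda>n. c n (I n)) \<longlonglongrightarrow> F y)"
  shows "(\<lambda>n. \<Sum>i<N n. c n i * (p n (Suc i) - p n i))
    \<longlonglongrightarrow> (\<integral>y. indicator {a..<b} y * F y \<partial>lborel)"
proof -
  have "(\<lambda>n. integral\<^sup>L lborel (step_fun (p n) (c n) (N n)))
    \<longlonglongrightarrow> (\<integral>y. indicator {a..<b} y * F y \<partial>lborel)"
  proof (rule integral_dominated_convergence)
    show "integrable lborel (\<lambda>y. indicator {a..<b} y * C)"
      by (cases "a \<le> b") auto
    show "AE y in lborel. (\<lambda>n. step_fun (p n) (c n) (N n) y) \<longlonglongrightarrow> indicator {a..<b} y * F y"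
      using lim
    proof (rule AE_mp, intro AE_I2 impI)
      fix y assume y: "y \<in> {a..<b} \<longrightarrow>
        (\<forall>I. (\<forall>n. I n < N n \<and> p n (I n) \<le> y \<and> y < p n (Suc (I n))) \<longrightarrow> (\<lambda>n. c n (I n)) \<longlonglongrightarrow> F y)"
      show "(\<lambda>n. step_fun (p n) (c n) (N n) y) \<longlonglongrightarrow> indicator {a..<b} y * F y"
      proof (cases "y \<in> {a..<b}")
        case True
        have "\<exists>i. i < N n \<and> p n i \<le> y \<and> y < p n (Suc i)" for n
          using partition_index[of "p n" y "N n"] True ends by (metis atLeastLessThan_iff)
        then obtain I where I: "\<And>n. I n < N n \<and> p n (I n) \<le> y \<and> y < p n (Suc (I n))" by metis
        have "step_fun (p n) (c n) (N n) y = c n (I n)" for n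
          using step_fun_eq[of "N n" "p n" "I n" y "c n"] mono I by simp
        then show ?thesis using y I True by simp
      next
        case False
        then have "step_fun (p n) (c n) (N n) y = 0" for n
          using step_fun_eq_0[of "N n" "p n" y "c n"] mono ends by simp
        then show ?thesis using False by simp
      qed
    qed
    show "AE y in lborel. norm (step_fun (p n) (c n) (N n) y) \<le> indicator {a..<b} y * C" for n
      using step_fun_bounded[of "N n" "p n" "c n" C] mono C ends by (intro AE_I2) simp
  qed measurable
  moreover have "integral\<^sup>L lborel (step_fun (p n) (c n) (N n))
      = (\<Sum>i<N n. c n i * (p n (Suc i) - p n i))" for n
    using mono by (intro integral_step_fun) simp
  ultimately show ?thesis by simp
qed

text \<open>Turns a sum over jumps into an integral over their gaps: \<open>F\<close> is
  \<open>c a\<close> on the gap \<open>U a\<close> and 0 off the gaps. The gaps are disjoint and lie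
  in a bounded interval, so their lengths are summable and the bounded weights keep the sum
  absolutely convergent.\<close>

lemma has_sum_integral_disjoint:
  fixes U :: "'a \<Rightarrow> real set" and c :: "'a \<Rightarrow> real"
  assumes J: "countable J" and U: "\<And>a. a \<in> J \<Longrightarrow> U a \<in> sets borel" and disj: "disjoint_family_on U J"
    and sub: "\<And>a. a \<in> J \<Longrightarrow> U a \<subseteq> {l..u}" and C: "\<And>a. a \<in> J \<Longrightarrow> \<bar>c a\<bar> \<le> C"
  obtains F where "F \<in> borel_measurable borel" "\<And>a y. a \<in> J \<Longrightarrow> y \<in> U a \<Longrightarrow> F y = c a"
    "\<And>y. y \<notin> \<Union>(U ` J) \<Longrightarrow> F y = 0"
    "((\<lambda>a. c a * measure lborel (U a)) has_sum (integral\<^sup>L lborel F)) J"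
proof -
  let ?e = "to_nat_on J" and ?e' = "from_nat_into J"
  \<comment> \<open>The family is reindexed by the natural numbers; codes outside the image of
    \<open>J\<close> get an empty set and weight 0, so that sums over all naturals are
    available.\<close>
  define V where "V k = (if k \<in> ?e ` J then U (?e' k) else {})" for k
  define d where "d k = (if k \<in> ?e ` J then c (?e' k) else 0)" for k
  define F where "F y = (\<Sum>k. indicator (V k) y * d k)" for y
  have ee: "?e' (?e a) = a" if "a \<in> J" for a using that J by simp
  have Ve: "V (?e a) = U a" "d (?e a) = c a" if "a \<in> J" for a
    using that J by (auto simp: V_def d_def)
  have [measurable]: "V k \<in> sets borel" for k using U ee by (auto simp: V_def)
  have Vdisj: "disjoint_family V"
    unfolding disjoint_family_on_def
  proof (intro ballI impI)
    fix m n :: nat assume "m \<noteq> n"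
    show "V m \<inter> V n = {}"
    proof (cases "m \<in> ?e ` J \<and> n \<in> ?e ` J")
      case True
      then obtain a b where ab: "a \<in> J" "b \<in> J" "m = ?e a" "n = ?e b" by auto
      with \<open>m \<noteq> n\<close> have "a \<noteq> b" by auto
      then show ?thesis using ab Ve disj by (auto simp: disjoint_family_on_def)
    qed (auto simp: V_def)
  qed
  have Vsub: "V k \<subseteq> {l..u}" for k using sub ee by (cases "k \<in> ?e ` J") (force simp: V_def)+
  have dC: "\<bar>d k\<bar> \<le> \<bar>C\<bar>" for k
    using C[of "?e' k"] ee by (fastforce simp: d_def)
  have Fval: "F y = d k" and Fsum: "summable (\<lambda>k. \<bar>indicator (V k) y * d k\<bar>)" if "y \<in> V k" for y k
  proof -
    have z: "indicator (V j) y * d j = 0" if "j \<noteq> k" for j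
      using Vdisj \<open>y \<in> V k\<close> that by (auto simp: disjoint_family_on_def indicator_def)
    have "(\<lambda>k. indicator (V k) y * d k) sums (\<Sum>j\<in>{k}. indicator (V j) y * d j)"
      using z by (intro sums_finite) auto
    then show "F y = d k" unfolding F_def using that by (simp add: sums_iff)
    have "(\<lambda>k. \<bar>indicator (V k) y * d k\<bar>) sums (\<Sum>j\<in>{k}. \<bar>indicator (V j) y * d j\<bar>)"
      using z by (intro sums_finite) auto
    then show "summable (\<lambda>k. \<bar>indicator (V k) y * d k\<bar>)" by (simp add: sums_iff)
  qed
  have F0: "F y = 0" and Fsum0: "summable (\<lambda>k. \<bar>indicator (V k) y * d k\<bar>)" if "\<And>k. y \<notin> V k" for y
    using that by (auto simp: F_def)
  have emfin: "emeasure lborel {l..u} < \<infinity>" by (cases "l \<le> u") auto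
  have Vfin: "emeasure lborel (V k) < \<infinity>" for k
    using emeasure_mono[OF Vsub, of lborel] by (metis emfin atLeastAtMost_borel le_less_trans sets_lborel)
  have UVfin: "emeasure lborel (\<Union>k. V k) \<noteq> \<infinity>"
    using emeasure_mono[of "\<Union>k. V k" "{l..u}" lborel] Vsub emfin
    by (metis (no_types, lifting) UN_least atLeastAtMost_borel le_less_trans order_less_irrefl sets_lborel)
  have msums: "(\<lambda>k. measure lborel (V k)) sums measure lborel (\<Union>k. V k)"
    by (rule measure_UNION) (use Vdisj UVfin in auto)
  have int: "integrable lborel (\<lambda>y. indicator (V k) y * d k)" for k
    using Vfin by (intro integrable_mult_left) auto
  have intn: "(\<integral>y. norm (indicator (V k) y * d k) \<partial>lborel) = measure lborel (V k) * \<bar>d k\<bar>" for k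
    by (simp add: abs_mult)
  have smb: "summable (\<lambda>k. measure lborel (V k) * \<bar>d k\<bar>)"
  proof (rule summable_comparison_test')
    show "summable (\<lambda>k. measure lborel (V k) * \<bar>C\<bar>)"
      using msums by (intro summable_mult2) (simp add: sums_iff)
    show "norm (measure lborel (V k) * \<bar>d k\<bar>) \<le> measure lborel (V k) * \<bar>C\<bar>" if "0 \<le> k" for k
      using dC[of k] by (simp add: mult_left_mono)
  qed
  have "(\<lambda>k. \<integral>y. indicator (V k) y * d k \<partial>lborel) sums (\<integral>y. (\<Sum>k. indicator (V k) y * d k) \<partial>lborel)"
  proof (rule sums_integral)
    show "AE y in lborel. summable (\<lambda>k. norm (indicator (V k) y * d k))"
    proof (rule AE_I2)
      show "summable (\<lambda>k. norm (indicator (V k) y * d k))" for y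
        using Fsum[of y] Fsum0[of y] unfolding real_norm_def by blast
    qed
    show "summable (\<lambda>k. \<integral>y. norm (indicator (V k) y * d k) \<partial>lborel)"
      using smb unfolding intn .
  qed (rule int)
  then have "(\<lambda>k. measure lborel (V k) * d k) sums integral\<^sup>L lborel F"
    unfolding F_def by simp
  \<comment> \<open>\<open>sums\<close> depends on the order while \<open>has_sum\<close> does not;
    absolute summability bridges the two.\<close>
  then have hs: "((\<lambda>k. measure lborel (V k) * d k) has_sum integral\<^sup>L lborel F) UNIV"
    using smb by (intro norm_summable_imp_has_sum) (simp_all add: abs_mult)
  have "((\<lambda>k. measure lborel (V k) * d k) has_sum integral\<^sup>L lborel F) (?e ` J)"
    using hs by (rule has_sum_cong_neutral[THEN iffD1, rotated -1]) (auto simp: V_def)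
  then have "((\<lambda>k. measure lborel (V k) * d k) \<circ> ?e has_sum integral\<^sup>L lborel F) J"
    using has_sum_reindex[OF inj_on_to_nat_on[OF J]] by blast
  then have "((\<lambda>a. c a * measure lborel (U a)) has_sum integral\<^sup>L lborel F) J"
    by (rule has_sum_cong[THEN iffD1, rotated]) (simp add: Ve mult.commute)
  moreover have "F \<in> borel_measurable borel" unfolding F_def by measurable
  moreover have "F y = c a" if "a \<in> J" "y \<in> U a" for a y
    using Fval[of y "?e a"] that Ve by simp
  moreover have "F y = 0" if "y \<notin> \<Union>(U ` J)" for y
    using that ee by (intro F0) (auto simp: V_def)
  ultimately show ?thesis using that by blast
qed

subsection \<open>Circle diffeomorphisms\<close>

lemma lift_add_int:
  fixes g :: "real \<Rightarrow> real"
  assumes "\<And>x. g (x + 1) = g x + 1"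
  shows "g (x + of_int k) = g x + of_int k"
proof (induction k rule: int_induct[where k = 0])
  case (step1 i)
  then show ?case using assms[of "x + of_int i"] by (simp add: add.assoc)
next
  case (step2 i)
  then show ?case using assms[of "x + of_int (i - 1)"] by simp
qed simp

lemma periodic_add_int:
  fixes g :: "real \<Rightarrow> 'a"
  assumes "\<And>x. g (x + 1) = g x"
  shows "g (x + of_int k) = g x"
proof (induction k rule: int_induct[where k = 0])
  case (step1 i)
  then show ?case using assms[of "x + of_int i"] by (simp add: add.assoc)
next
  case (step2 i)
  then show ?case using assms[of "x + of_int (i - 1)"] by simp
qed simp

lemma periodic_frac:
  fixes g :: "real \<Rightarrow> 'a"
  assumes "\<And>x. g (x + 1) = g x"
  shows "g (frac x) = g x"
  using periodic_add_int[of g "frac x" "\<lfloor>x\<rfloor>"] assms by (simp add: frac_def)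

lemma lift_frac:
  fixes g :: "real \<Rightarrow> real"
  assumes "\<And>x. g (x + 1) = g x + 1"
  shows "g (frac x) = g x - of_int \<lfloor>x\<rfloor>"
  using lift_add_int[of g "frac x" "\<lfloor>x\<rfloor>"] assms by (simp add: frac_def)

text \<open>A mean value theorem in which the order of \<open>u\<close> and \<open>v\<close> is left
  open: it will be applied to \<open>f x\<close> and a difference quotient of \<open>H\<close>,
  either of which may be the larger.\<close>

lemma ln_diff_mvt:
  fixes u v :: real
  assumes "u > 0" "v > 0"
  obtains w where "min u v \<le> w" "w \<le> max u v" "ln v - ln u = (v - u) / w"
proof -
  have *: "\<exists>w. a < w \<and> w < b \<and> ln b - ln a = (b - a) * (1 / w)" if "0 < a" "a < b" for a b :: real
    using that by (intro MVT2) (auto intro!: derivative_eq_intros)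
  consider "u = v" | "u < v" | "v < u" by linarith
  then show ?thesis
  proof cases
    case 1 then show ?thesis using that[of u] by simp
  next
    case 2 then show ?thesis using *[of u v] assms that by force
  next
    case 3
    then obtain w where "v < w" "w < u" "ln u - ln v = (u - v) * (1 / w)" using *[of v u] assms by blast
    then show ?thesis using that[of w] assms by (simp add: field_simps)
  qed
qed

lemma periodic_bounded:
  fixes g :: "real \<Rightarrow> real"
  assumes "\<And>x. isCont g x" "\<And>x. g (x + 1) = g x"
  obtains B where "B \<ge> 0" "\<And>x. \<bar>g x\<bar> \<le> B"
proof -
  have "compact (g ` {0..1})"
    using assms by (intro compact_continuous_image) (auto simp: continuous_at_imp_continuous_on)
  then have "bounded (g ` {0..1})" by (rule compact_imp_bounded)
  then obtain B where B: "\<forall>y\<in>g ` {0..1}. norm y \<le> B"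
    unfolding bounded_iff ..
  have "\<bar>g x\<bar> \<le> \<bar>B\<bar>" for x
  proof -
    have "frac x \<in> {0..1}" using frac_lt_1[of x] by simp
    then have "norm (g (frac x)) \<le> B" using B by blast
    then show ?thesis using periodic_frac[of g x] assms(2) by simp
  qed
  then show ?thesis using that[of "\<bar>B\<bar>"] by simp
qed

text \<open>All computations take place on a lift \<open>H\<close>. The derivatives are explicit
  parameters, which become iterated \<open>deriv\<close> of the chosen lift when the locale is
  interpreted at the end.\<close>

locale circle_diffeo =
  fixes H f f' :: "real \<Rightarrow> real"
  assumes deriv_H: "\<And>x. (H has_real_derivative f x) (at x)"
    and f_pos: "\<And>x. f x > 0"
    and H_per: "\<And>x. H (x + 1) = H x + 1"
    and deriv_f: "\<And>x. (f has_real_derivative f' x) (at x)"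
    and cont_f': "continuous_on UNIV f'"
begin

lemma H_mono: "x < y \<Longrightarrow> H x < H y"
  using DERIV_pos_imp_increasing[of x y H] deriv_H f_pos by blast

lemma H_mono_le: "x \<le> y \<Longrightarrow> H x \<le> H y"
  using H_mono[of x y] by (cases "x = y") auto

lemma H_less_iff: "H x < H y \<longleftrightarrow> x < y"
  using H_mono H_mono_le by (meson linorder_not_le)

lemma f_per: "f (x + 1) = f x"
proof -
  have "((\<lambda>x. H (x + 1)) has_real_derivative f (x + 1)) (at x)"
    using deriv_H[of "x + 1"] by (simp add: DERIV_shift)
  moreover have "((\<lambda>x. H (x + 1)) has_real_derivative f x) (at x)"
    unfolding H_per using deriv_H by (auto intro!: derivative_eq_intros)
  ultimately show ?thesis by (rule DERIV_unique)
qed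

lemma f'_per: "f' (x + 1) = f' x"
proof -
  have "((\<lambda>x. f (x + 1)) has_real_derivative f' (x + 1)) (at x)"
    using deriv_f[of "x + 1"] by (simp add: DERIV_shift)
  moreover have "((\<lambda>x. f (x + 1)) has_real_derivative f' x) (at x)"
    unfolding f_per using deriv_f by simp
  ultimately show ?thesis by (rule DERIV_unique)
qed

lemma f_frac: "f (frac x) = f x"
  using periodic_frac[of f x] f_per by simp

lemma cont_H: "isCont H x"
  using deriv_H DERIV_isCont by blast

lemma cont_f: "isCont f x"
  using deriv_f DERIV_isCont by blast

lemma isCont_f': "isCont f' x"
  using cont_f' by (simp add: continuous_on_eq_continuous_at)

lemma f_measurable [measurable]: "f \<in> borel_measurable borel"
  using cont_f by (intro borel_measurable_continuous_onI) (simp add: continuous_at_imp_continuous_on)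

lemma H_measurable [measurable]: "H \<in> borel_measurable borel"
  using cont_H by (intro borel_measurable_continuous_onI) (simp add: continuous_at_imp_continuous_on)

lemma ln_f_bounded: obtains L where "L \<ge> 0" "\<And>x. \<bar>ln (f x)\<bar> \<le> L"
proof (rule periodic_bounded[of "\<lambda>x. ln (f x)"])
  show "isCont (\<lambda>x. ln (f x)) x" for x
    using f_pos[of x] cont_f[of x] by (intro continuous_intros) auto
qed (auto simp: f_per)

lemma deriv_ln_f: "((\<lambda>x. ln (f x)) has_real_derivative f' x / f x) (at x)"
  using f_pos[of x] deriv_f[of x] by (auto intro!: derivative_eq_intros)

text \<open>The derivative \<open>f' / f\<close> is continuous and periodic, hence bounded on the
  whole line. The constant \<open>B\<close> obtained here dominates all step functions over the
  range of a lift.\<close>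

lemma ln_f_lipschitz: obtains B where "B \<ge> 0" "\<And>x y. \<bar>ln (f x) - ln (f y)\<bar> \<le> B * \<bar>x - y\<bar>"
proof -
  have "isCont (\<lambda>x. f' x / f x) x" for x
    using f_pos[of x] cont_f[of x] isCont_f'[of x] by (intro continuous_intros) auto
  then obtain B where B: "B \<ge> 0" "\<And>x. \<bar>f' x / f x\<bar> \<le> B"
    using periodic_bounded[of "\<lambda>x. f' x / f x"] f_per f'_per by auto
  have *: "\<bar>ln (f y) - ln (f x)\<bar> \<le> B * (y - x)" if xy: "x < y" for x y
  proof -
    obtain z where "ln (f y) - ln (f x) = (y - x) * (f' z / f z)"
      using MVT2[OF xy, of "\<lambda>x. ln (f x)" "\<lambda>x. f' x / f x"] deriv_ln_f by blast
    then show ?thesis using xy B(2)[of z] mult_left_mono[of "\<bar>f' z / f z\<bar>" B "y - x"]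
      by (simp add: abs_mult mult.commute)
  qed
  have "\<bar>ln (f x) - ln (f y)\<bar> \<le> B * \<bar>x - y\<bar>" for x y
    using *[of x y] *[of y x] by (cases x y rule: linorder_cases) (auto simp: abs_minus_commute)
  then show ?thesis using that B by blast
qed

text \<open>The value on the diagonal is the continuous extension, so that grid intervals on which a
  lift is constant contribute the right power of \<open>f\<close>.\<close>

definition slope :: "real \<Rightarrow> real \<Rightarrow> real" where
  "slope x y = (if x = y then f x else (H y - H x) / (y - x))"

text \<open>For \<open>x < y\<close> this is the logarithm of the factor that a jump from
  \<open>x\<close> to \<open>y\<close> contributes to \<open>Y0\<close>.\<close>

definition q :: "real \<Rightarrow> real \<Rightarrow> real" where
  "q x y = (ln (f x) + ln (f y)) / 2 - ln (slope x y)"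

lemma slope_mvt:
  assumes "x \<le> y"
  obtains z where "x \<le> z" "z \<le> y" "slope x y = f z"
proof (cases "x = y")
  case False
  then have xy: "x < y" using assms by simp
  obtain z where "x < z" "z < y" "H y - H x = (y - x) * f z"
    using MVT2[OF xy, of H f] deriv_H by blast
  then show ?thesis using that[of z] xy by (simp add: slope_def)
qed (use that[of x] in \<open>simp add: slope_def\<close>)

lemma slope_pos: "x \<le> y \<Longrightarrow> slope x y > 0"
  using slope_mvt[of x y] f_pos by metis

lemma slope_shift: "slope (x + of_int k) (y + of_int k) = slope x y"
  using lift_add_int[of H _ k] periodic_add_int[of f _ k] H_per f_per by (simp add: slope_def)

lemma q_shift: "q (x + of_int k) (y + of_int k) = q x y"
  using periodic_add_int[of f _ k] f_per slope_shift[of x k y] by (simp add: q_def)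

lemma q_refl [simp]: "q x x = 0"
  by (simp add: q_def slope_def)

lemma ln_slope_bounded:
  assumes "\<And>x. \<bar>ln (f x)\<bar> \<le> L" "x \<le> y"
  shows "\<bar>ln (slope x y)\<bar> \<le> L"
  using slope_mvt[OF assms(2)] assms(1) by metis

text \<open>The slope is the value of \<open>f\<close> at an intermediate point, so \<open>q\<close>
  is an average of two differences of \<open>ln f\<close>. The bound is linear in the increment and
  therefore telescopes over a partition.\<close>

lemma q_bounded:
  assumes B: "\<And>x y. \<bar>ln (f x) - ln (f y)\<bar> \<le> B * \<bar>x - y\<bar>" and xy: "x \<le> y"
  shows "\<bar>q x y\<bar> \<le> B * (y - x)"
proof -
  obtain z where z: "x \<le> z" "z \<le> y" "slope x y = f z" using slope_mvt[OF xy] .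
  have "\<bar>q x y\<bar> \<le> (\<bar>ln (f x) - ln (f z)\<bar> + \<bar>ln (f y) - ln (f z)\<bar>) / 2"
    unfolding q_def z(3) by (simp add: abs_if field_simps)
  also have "\<dots> \<le> (B * (z - x) + B * (y - z)) / 2"
    using B[of x z] B[of y z] z by simp
  also have "\<dots> = B * (y - x) / 2" by (simp add: algebra_simps)
  also have "\<dots> \<le> B * (y - x)" using B[of x y] xy by (simp add: abs_if split: if_splits)
  finally show ?thesis .
qed

lemma slope_tendsto:
  assumes "\<And>n::nat. x n \<le> y n" "x \<longlonglongrightarrow> z" "y \<longlonglongrightarrow> z"
  shows "(\<lambda>n. slope (x n) (y n)) \<longlonglongrightarrow> f z"
proof -
  have "\<exists>w. x n \<le> w \<and> w \<le> y n \<and> slope (x n) (y n) = f w" for n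
    using slope_mvt[OF assms(1)] by metis
  then obtain w where w: "\<And>n. x n \<le> w n" "\<And>n. w n \<le> y n" "\<And>n. slope (x n) (y n) = f (w n)"
    by metis
  have "w \<longlonglongrightarrow> z"
    by (rule tendsto_sandwich[OF _ _ assms(2,3)]) (use w in auto)
  then show ?thesis unfolding w(3) using cont_f isCont_tendsto_compose by blast
qed

text \<open>To first order, half the increment of \<open>ln f\<close> and the difference of
  \<open>ln (slope x y)\<close> and \<open>ln (f x)\<close> are both \<open>f' / (2 * f)\<close>
  times \<open>y - x\<close>. The mean value and Taylor theorems express each coefficient through
  intermediate points, and continuity of \<open>f'\<close> makes the coefficients cancel in the
  limit.\<close>

lemma q_little_o:
  assumes xy: "\<And>n::nat. x n < y n" and lim: "x \<longlonglongrightarrow> z" "y \<longlonglongrightarrow> z"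
  shows "(\<lambda>n. q (x n) (y n) / (y n - x n)) \<longlonglongrightarrow> 0"
proof -
  have "\<exists>s t w. x n \<le> s \<and> s \<le> y n \<and> x n \<le> t \<and> t \<le> y n \<and>
      min (f (x n)) (slope (x n) (y n)) \<le> w \<and> w \<le> max (f (x n)) (slope (x n) (y n)) \<and>
      q (x n) (y n) / (y n - x n) = (f' s / f s - f' t / w) / 2" for n
  proof -
    let ?x = "x n" and ?y = "y n"
    have d: "?x < ?y" using xy .
    obtain s where s: "?x < s" "s < ?y" "ln (f ?y) - ln (f ?x) = (?y - ?x) * (f' s / f s)"
      using MVT2[OF d, of "\<lambda>x. ln (f x)" "\<lambda>x. f' x / f x"] deriv_ln_f by blast
    \<comment> \<open>\<open>H\<close>, \<open>f\<close>, \<open>f'\<close> as the sequence of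
      derivatives for a Taylor expansion of order two; its Lagrange remainder gives the difference
      of slope and \<open>f\<close> in closed form.\<close>
    define D where "D = (\<lambda>m::nat. if m = 0 then H else if m = 1 then f else f')"
    have "\<exists>t>?x. t < ?y \<and> H ?y = (\<Sum>m<2. D m ?x / fact m * (?y - ?x) ^ m) + D 2 t / fact 2 * (?y - ?x) ^ 2"
    proof (rule Taylor_up[where a = ?x])
      show "\<forall>m t. m < 2 \<and> ?x \<le> t \<and> t \<le> ?y \<longrightarrow> (D m has_real_derivative D (Suc m) t) (at t)"
        using deriv_H deriv_f by (simp add: D_def less_2_cases_iff)
    qed (use d in \<open>simp_all add: D_def\<close>)
    moreover have "(\<Sum>m<2. D m ?x / fact m * (?y - ?x) ^ m) = H ?x + f ?x * (?y - ?x)"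
      by (simp add: D_def numeral_2_eq_2 del: power_Suc)
    moreover have "D 2 = f'" by (simp add: D_def)
    ultimately obtain t where t: "?x < t" "t < ?y" "H ?y = H ?x + f ?x * (?y - ?x) + f' t / 2 * (?y - ?x)\<^sup>2"
      by auto
    have sl: "slope ?x ?y - f ?x = f' t / 2 * (?y - ?x)"
      using d t(3) by (simp add: slope_def field_simps power2_eq_square)
    have "slope ?x ?y > 0" using slope_pos d by simp
    then obtain w where w: "min (f ?x) (slope ?x ?y) \<le> w" "w \<le> max (f ?x) (slope ?x ?y)"
      "ln (slope ?x ?y) - ln (f ?x) = (slope ?x ?y - f ?x) / w"
      using ln_diff_mvt f_pos by metis
    have "w > 0" using w(1) \<open>slope ?x ?y > 0\<close> f_pos[of ?x] by (auto simp: min_def split: if_splits)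
    \<comment> \<open>Both logarithms are compared with \<open>ln (f ?x)\<close>, so that each of
      the two differences is covered by one of the expansions above.\<close>
    have "q ?x ?y = (ln (f ?y) - ln (f ?x)) / 2 - (ln (slope ?x ?y) - ln (f ?x))"
      unfolding q_def by (simp add: field_simps)
    also have "\<dots> = (?y - ?x) * ((f' s / f s - f' t / w) / 2)"
      unfolding w(3) sl s(3) using \<open>w > 0\<close> f_pos[of s] by (simp add: field_simps)
    finally have "q ?x ?y / (?y - ?x) = (f' s / f s - f' t / w) / 2" using d by simp
    then show ?thesis using s t w by (intro exI[of _ s] exI[of _ t] exI[of _ w]) simp
  qed
  then obtain s t w where stw: "\<And>n. x n \<le> s n" "\<And>n. s n \<le> y n" "\<And>n. x n \<le> t n" "\<And>n. t n \<le> y n"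
    "\<And>n. min (f (x n)) (slope (x n) (y n)) \<le> w n" "\<And>n. w n \<le> max (f (x n)) (slope (x n) (y n))"
    "\<And>n. q (x n) (y n) / (y n - x n) = (f' (s n) / f (s n) - f' (t n) / w n) / 2"
    by metis
  have s: "s \<longlonglongrightarrow> z" and t: "t \<longlonglongrightarrow> z"
    by (rule tendsto_sandwich[OF _ _ lim]; use stw in auto)+
  have fx: "(\<lambda>n. f (x n)) \<longlonglongrightarrow> f z" using lim cont_f isCont_tendsto_compose by blast
  have sl: "(\<lambda>n. slope (x n) (y n)) \<longlonglongrightarrow> f z" using slope_tendsto lim xy by (meson less_imp_le)
  have "(\<lambda>n. min (f (x n)) (slope (x n) (y n))) \<longlonglongrightarrow> f z"
    using tendsto_min[OF fx sl] by simp
  moreover have "(\<lambda>n. max (f (x n)) (slope (x n) (y n))) \<longlonglongrightarrow> f z"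
    using tendsto_max[OF fx sl] by simp
  ultimately have w: "w \<longlonglongrightarrow> f z"
    by (rule tendsto_sandwich[rotated 2]) (use stw in auto)
  have "f z \<noteq> 0" using f_pos[of z] by simp
  then have "(\<lambda>n. (f' (s n) / f (s n) - f' (t n) / w n) / 2) \<longlonglongrightarrow> (f' z / f z - f' z / f z) / 2"
    using s t w cont_f isCont_f' by (intro tendsto_intros isCont_tendsto_compose[of z f'] isCont_tendsto_compose[of z f]) simp_all
  then show ?thesis unfolding stw(7) by simp
qed

end

subsection \<open>One-sided limits of lifts\<close>

lemma is_liftD:
  assumes "is_lift G"
  shows "mono G" "G (x + 1) = G x + 1" "continuous (at_right x) G"
  using assms by (auto simp: is_lift_def)

text \<open>\<open>Lim\<close> is a definite description, so nothing can be derived about it before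
  a limit is exhibited; for a monotone function it is the supremum of the values to the
  left.\<close>

lemma mono_Lim_at_left:
  fixes G :: "real \<Rightarrow> real"
  assumes "mono G"
  shows "(G \<longlongrightarrow> Lim (at_left a) G) (at_left a)"
proof -
  have ub: "bdd_above (G ` {..<a})"
    using monoD[OF assms] by (intro bdd_aboveI2[of _ _ "G a"]) simp
  have "(G \<longlongrightarrow> (SUP s\<in>{..<a}. G s)) (at_left a)"
  proof (rule increasing_tendsto)
    show "\<forall>\<^sub>F s in at_left a. G s \<le> (SUP s\<in>{..<a}. G s)"
      using cSUP_upper[OF _ ub] by (auto simp: eventually_at_filter)
    fix x assume "x < (SUP s\<in>{..<a}. G s)"
    then obtain s where s: "s < a" "x < G s"
      using less_cSUP_iff[OF _ ub] by auto
    have "\<forall>\<^sub>F r in at_left a. r \<in> {s<..<a}"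
      using s(1) eventually_at_left_field by (auto simp: eventually_at_left_field)
    then show "\<forall>\<^sub>F r in at_left a. x < G r"
    proof eventually_elim
      case (elim r)
      then have "G s \<le> G r" using monoD[OF assms, of s r] by simp
      then show ?case using s by simp
    qed
  qed
  from tendsto_Lim[OF trivial_limit_at_left_real this] this show ?thesis by simp
qed

lemma mono_Lim_at_left_le:
  fixes G :: "real \<Rightarrow> real"
  assumes "mono G"
  shows "Lim (at_left a) G \<le> G a"
proof (rule tendsto_upperbound[OF mono_Lim_at_left[OF assms]])
  show "\<forall>\<^sub>F s in at_left a. G s \<le> G a"
    using monoD[OF assms] by (auto simp: eventually_at_filter)
qed simp

lemma mono_le_Lim_at_left:
  fixes G :: "real \<Rightarrow> real"
  assumes "mono G" "s < a"
  shows "G s \<le> Lim (at_left a) G"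
proof (rule tendsto_lowerbound[OF mono_Lim_at_left[OF assms(1)]])
  have "\<forall>\<^sub>F r in at_left a. r \<in> {s<..<a}"
    using assms(2) by (auto simp: eventually_at_left_field)
  then show "\<forall>\<^sub>F r in at_left a. G s \<le> G r"
    by eventually_elim (use monoD[OF assms(1)] in \<open>simp add: less_imp_le\<close>)
qed simp

text \<open>Serves to carry a jump at 0 over to a jump at 1.\<close>

lemma lift_Lim_add_1:
  assumes "is_lift G"
  shows "Lim (at_left (a + 1)) G = Lim (at_left a) G + 1"
proof -
  have "((\<lambda>x. G (x + 1)) \<longlongrightarrow> Lim (at_left (a + 1)) G) (at_left a)"
  proof (rule filterlim_compose[OF mono_Lim_at_left[OF is_liftD(1)[OF assms]]])
    show "filterlim (\<lambda>x. x + 1) (at_left (a + 1)) (at_left a)"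
      unfolding filterlim_at
      by (auto intro!: tendsto_eq_intros simp: eventually_at_filter)
  qed
  then have "(G \<longlongrightarrow> Lim (at_left (a + 1)) G - 1) (at_left a)"
    using tendsto_diff[OF _ tendsto_const[of 1]] is_liftD(2)[OF assms] by fastforce
  then show ?thesis
    using tendsto_Lim[of "at_left a" G] by simp
qed

lemma lift_isCont_iff_Lim:
  assumes "is_lift G"
  shows "isCont G a \<longleftrightarrow> Lim (at_left a) G = G a"
proof
  assume "isCont G a"
  then have "(G \<longlongrightarrow> G a) (at_left a)" by (simp add: isCont_def filterlim_at_split)
  then show "Lim (at_left a) G = G a" by (simp add: tendsto_Lim)
next
  assume "Lim (at_left a) G = G a"
  then have "(G \<longlongrightarrow> G a) (at_left a)" using mono_Lim_at_left is_liftD(1)[OF assms] by metis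
  moreover have "(G \<longlongrightarrow> G a) (at_right a)"
    using is_liftD(3)[OF assms, of a] by (simp add: continuous_within)
  ultimately show "isCont G a" by (simp add: isCont_def filterlim_at_split)
qed

text \<open>The sequence may hit \<open>a\<close>, which the filter \<open>at_right a\<close>
  excludes; hence the passage to \<open>{a..}\<close>.\<close>

lemma lift_tendsto_from_right:
  assumes "is_lift G" "\<And>n. a \<le> s n" "s \<longlonglongrightarrow> a"
  shows "(\<lambda>n. G (s n)) \<longlonglongrightarrow> G a"
proof -
  have "continuous (at a within {a..}) G"
    using is_liftD(3)[OF assms(1), of a] by (simp add: at_within_Ici_at_right)
  then show ?thesis
    by (rule continuous_within_tendsto_compose'[OF _ _ assms(3)]) (use assms(2) in auto)
qed

lemma lift_discont_countable:
  assumes "is_lift G"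
  shows "countable {a. \<not> isCont G a}"
  using mono_ctble_discont[OF is_liftD(1)[OF assms]] .

section \<open>Dyadic grids of the unit interval\<close>

definition grid :: "nat \<Rightarrow> nat \<Rightarrow> real" where
  "grid n i = real i / 2 ^ n"

lemma grid_0 [simp]: "grid n 0 = 0"
  by (simp add: grid_def)

text \<open>Lifts are evaluated at this last point, so 1 is kept apart from 0; families of circle
  values wrap around with \<open>Suc i mod 2 ^ n\<close> instead.\<close>

lemma grid_top [simp]: "grid n (2 ^ n) = 1"
  by (simp add: grid_def)

lemma grid_le: "grid n i \<le> grid n (Suc i)"
  by (simp add: grid_def divide_right_mono)

lemma grid_diff: "grid n (Suc i) - grid n i = 1 / 2 ^ n"
  by (simp add: grid_def field_simps)

lemma inverse_pow2_tendsto_0: "(\<lambda>n. 1 / 2 ^ n :: real) \<longlonglongrightarrow> 0"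
  using LIMSEQ_realpow_zero[of "1/2 :: real"] by (simp add: power_one_over)

text \<open>Both inequalities are weak because the point \<open>a\<close> at which a lift passes a
  given level may itself be a grid point.\<close>

lemma grid_squeeze:
  assumes "\<And>n. grid n (I n) \<le> a" "\<And>n. a \<le> grid n (Suc (I n))"
  shows "(\<lambda>n. grid n (I n)) \<longlonglongrightarrow> a" "(\<lambda>n. grid n (Suc (I n))) \<longlonglongrightarrow> a"
proof -
  have "(\<lambda>n. a - 1 / 2 ^ n) \<longlonglongrightarrow> a - 0" by (intro tendsto_intros inverse_pow2_tendsto_0)
  then have l: "(\<lambda>n. a - 1 / 2 ^ n) \<longlonglongrightarrow> a" by simp
  have "(\<lambda>n. a + 1 / 2 ^ n) \<longlonglongrightarrow> a + 0" by (intro tendsto_intros inverse_pow2_tendsto_0)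
  then have u: "(\<lambda>n. a + 1 / 2 ^ n) \<longlonglongrightarrow> a" by simp
  have *: "a - 1 / 2 ^ n \<le> grid n (I n)" "grid n (Suc (I n)) \<le> a + 1 / 2 ^ n" for n
    using grid_diff[of n "I n"] assms(1,2)[of n] by linarith+
  show "(\<lambda>n. grid n (I n)) \<longlonglongrightarrow> a"
    by (rule tendsto_sandwich[OF _ _ l tendsto_const]) (use * assms in auto)
  show "(\<lambda>n. grid n (Suc (I n))) \<longlonglongrightarrow> a"
    by (rule tendsto_sandwich[OF _ _ tendsto_const u]) (use * assms in auto)
qed

subsection \<open>Dyadic approximation of the density\<close>

context circle_diffeo
begin

text \<open>The weights are the lengths of the grid intervals. Where \<open>G\<close> is continuous,
  both values around \<open>s\<close> tend to \<open>G s\<close> and the slope tends to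
  \<open>f (G s)\<close>; the discontinuities are countable, hence null.\<close>

lemma slope_sums_tendsto:
  assumes G: "is_lift G"
  shows "(\<lambda>n. \<Sum>i<2 ^ n. ln (slope (G (grid n i)) (G (grid n (Suc i)))) * (1 / 2 ^ n))
    \<longlonglongrightarrow> (\<integral>s. indicator {0..<1} s * ln (f (G s)) \<partial>lborel)"
proof -
  obtain L where L: "\<And>x. \<bar>ln (f x)\<bar> \<le> L" using ln_f_bounded by metis
  have m: "G (grid n i) \<le> G (grid n (Suc i))" for n i
    using grid_le monoD[OF is_liftD(1)[OF G]] by blast
  have [measurable]: "G \<in> borel_measurable borel"
    using borel_measurable_mono is_liftD(1)[OF G] by blast
  have "(\<lambda>n. \<Sum>i<2 ^ n. ln (slope (G (grid n i)) (G (grid n (Suc i)))) * (grid n (Suc i) - grid n i))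
    \<longlonglongrightarrow> (\<integral>s. indicator {0..<1} s * ln (f (G s)) \<partial>lborel)"
  proof (rule step_sums_tendsto[where C = L])
    show "\<bar>ln (slope (G (grid n i)) (G (grid n (Suc i))))\<bar> \<le> L" for n i
      using ln_slope_bounded[OF L m] .
    have "AE s in lborel. s \<notin> {a. \<not> isCont G a}"
      by (intro AE_not_in countable_imp_null_set_lborel lift_discont_countable G)
    then show "AE s in lborel. s \<in> {0..<1} \<longrightarrow>
      (\<forall>I. (\<forall>n. I n < 2 ^ n \<and> grid n (I n) \<le> s \<and> s < grid n (Suc (I n))) \<longrightarrow>
        (\<lambda>n. ln (slope (G (grid n (I n))) (G (grid n (Suc (I n)))))) \<longlonglongrightarrow> ln (f (G s)))"
    proof (rule AE_mp, intro AE_I2 impI allI)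
      fix s :: real and I
      assume s: "s \<notin> {a. \<not> isCont G a}"
        and I: "\<forall>n. I n < 2 ^ n \<and> grid n (I n) \<le> s \<and> s < grid n (Suc (I n))"
      have lims: "(\<lambda>n. grid n (I n)) \<longlonglongrightarrow> s" "(\<lambda>n. grid n (Suc (I n))) \<longlonglongrightarrow> s"
        using grid_squeeze[of I s] I by (auto simp: less_imp_le)
      have c: "isCont G s" using s by simp
      have "(\<lambda>n. slope (G (grid n (I n))) (G (grid n (Suc (I n))))) \<longlonglongrightarrow> f (G s)"
        by (intro slope_tendsto m isCont_tendsto_compose[OF c] lims)
      then show "(\<lambda>n. ln (slope (G (grid n (I n))) (G (grid n (Suc (I n)))))) \<longlonglongrightarrow> ln (f (G s))"
        using f_pos[of "G s"] by (intro tendsto_ln) auto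
    qed
  qed (auto simp: grid_le)
  then show ?thesis by (simp add: grid_diff)
qed

text \<open>The counterpart of \<open>q_little_o\<close> at a jump, where the increments do not
  shrink.\<close>

lemma q_tendsto:
  assumes "x \<longlonglongrightarrow> a" "y \<longlonglongrightarrow> b" "a < b" "\<And>n::nat. x n < y n"
  shows "(\<lambda>n. q (x n) (y n)) \<longlonglongrightarrow> q a b"
proof -
  have "(\<lambda>n. (H (y n) - H (x n)) / (y n - x n)) \<longlonglongrightarrow> (H b - H a) / (b - a)"
    using assms by (intro tendsto_intros isCont_tendsto_compose[OF cont_H]) auto
  then have "(\<lambda>n. slope (x n) (y n)) \<longlonglongrightarrow> slope a b"
    using assms(3,4) by (simp add: slope_def less_imp_neq)
  moreover have "slope a b \<noteq> 0" using slope_pos[of a b] assms(3) by simp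
  ultimately show ?thesis unfolding q_def
    using f_pos[of a] f_pos[of b] assms
    by (intro tendsto_intros isCont_tendsto_compose[OF cont_f]) auto
qed

text \<open>The points \<open>G (grid n i)\<close> partition the range \<open>{G 0..<G 1}\<close>,
  and the mesh need not tend to 0: the cells around a level inside a gap shrink only to that gap.
  The limit of \<open>q / (y - x)\<close> is therefore constant on each gap, and its integral over
  the gap is the term of the jump.\<close>

lemma q_sums_tendsto:
  assumes G: "is_lift G"
  shows "(\<lambda>n. \<Sum>i<2 ^ n. q (G (grid n i)) (G (grid n (Suc i))))
    \<longlonglongrightarrow> (\<Sum>\<^sub>\<infinity>a\<in>jumps G. q (Lim (at_left a) G) (G a))"
proof -
  let ?l = "\<lambda>a. Lim (at_left a) G"
  \<comment> \<open>Jumps are taken in (0,1] and not in [0,1) as in \<open>jumps\<close>: the gap of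
    a jump at 0 lies below \<open>G 0\<close>, while that of the jump at 1 lies inside
    \<open>{G 0..<G 1}\<close>.\<close>
  define J where "J = {a \<in> {0<..1}. ?l a < G a}"
  define U where "U a = {?l a<..<G a}" for a
  define c where "c a = q (?l a) (G a) / (G a - ?l a)" for a
  note mG = is_liftD(1)[OF G]
  note le = mono_Lim_at_left_le[OF mG] and ge = mono_le_Lim_at_left[OF mG]
  have m: "G (grid n i) \<le> G (grid n (Suc i))" for n i
    using grid_le monoD[OF mG] by blast
  obtain B where B: "B \<ge> 0" "\<And>x y. \<bar>ln (f x) - ln (f y)\<bar> \<le> B * \<bar>x - y\<bar>"
    using ln_f_lipschitz by metis
  \<comment> \<open>For \<open>x = y\<close> the quotient is 0 by the convention on
    division.\<close>
  have qB: "\<bar>q x y / (y - x)\<bar> \<le> B" if "x \<le> y" for x y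
    using q_bounded[OF B(2) that] that B(1) by (cases "x = y") (auto simp: field_simps)
  have J: "countable J"
  proof (rule countable_subset[OF _ lift_discont_countable[OF G]])
    show "J \<subseteq> {a. \<not> isCont G a}" using lift_isCont_iff_Lim[OF G] by (auto simp: J_def)
  qed
  have disj: "disjoint_family_on U J"
    unfolding disjoint_family_on_def
  proof (intro ballI impI)
    fix a b :: real assume "a \<noteq> b"
    then show "U a \<inter> U b = {}"
      using ge[of a b] ge[of b a] by (cases "a < b") (auto simp: U_def)
  qed
  have Usub: "U a \<subseteq> {G 0..<G 1}" if "a \<in> J" for a
    using that ge[of 0 a] monoD[OF mG, of a 1] by (auto simp: U_def J_def)
  obtain F where F: "F \<in> borel_measurable borel" "\<And>a y. a \<in> J \<Longrightarrow> y \<in> U a \<Longrightarrow> F y = c a"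
    "\<And>y. y \<notin> \<Union>(U ` J) \<Longrightarrow> F y = 0"
    "((\<lambda>a. c a * measure lborel (U a)) has_sum (integral\<^sup>L lborel F)) J"
  proof (rule has_sum_integral_disjoint[OF J _ disj, of "G 0" "G 1" c B])
    show "U a \<in> sets borel" for a by (simp add: U_def)
    show "U a \<subseteq> {G 0..G 1}" if "a \<in> J" for a using Usub[OF that] by auto
    show "\<bar>c a\<bar> \<le> B" if "a \<in> J" for a using qB le[of a] by (simp add: c_def)
  qed blast
  have "(\<lambda>n. \<Sum>i<2 ^ n. q (G (grid n i)) (G (grid n (Suc i))) / (G (grid n (Suc i)) - G (grid n i))
      * (G (grid n (Suc i)) - G (grid n i)))
    \<longlonglongrightarrow> (\<integral>y. indicator {G 0..<G 1} y * F y \<partial>lborel)"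
  proof (rule step_sums_tendsto[where C = B])
    show "\<bar>q (G (grid n i)) (G (grid n (Suc i))) / (G (grid n (Suc i)) - G (grid n i))\<bar> \<le> B" for n i
      using qB m .
    \<comment> \<open>Endpoints of gaps are discarded, and so is \<open>G 0\<close>, which keeps the
      point \<open>a\<close> below away from 0.\<close>
    have "AE y in lborel. y \<notin> insert (G 0) (?l ` J \<union> G ` J)"
      using J by (intro AE_not_in countable_imp_null_set_lborel) auto
    then show "AE y in lborel. y \<in> {G 0..<G 1} \<longrightarrow>
      (\<forall>I. (\<forall>n. I n < 2 ^ n \<and> G (grid n (I n)) \<le> y \<and> y < G (grid n (Suc (I n)))) \<longrightarrow>
        (\<lambda>n. q (G (grid n (I n))) (G (grid n (Suc (I n))))
          / (G (grid n (Suc (I n))) - G (grid n (I n)))) \<longlonglongrightarrow> F y)"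
    proof (rule AE_mp, intro AE_I2 impI allI)
      fix y :: real and I
      assume y: "y \<notin> insert (G 0) (?l ` J \<union> G ` J)" and y01: "y \<in> {G 0..<G 1}"
        and I: "\<forall>n. I n < 2 ^ n \<and> G (grid n (I n)) \<le> y \<and> y < G (grid n (Suc (I n)))"
      \<comment> \<open>The generalised inverse of \<open>G\<close> at level \<open>y\<close>: the
        time \<open>a\<close> at which \<open>G\<close> passes \<open>y\<close>, so that
        \<open>y\<close> lies between the left limit and the value of \<open>G\<close> at
        \<open>a\<close>.\<close>
      let ?S = "{t. G t \<le> y}"
      define a where "a = Sup ?S"
      have Sub: "t \<le> 1" if "G t \<le> y" for t
        using that y01 monoD[OF mG, of 1 t] by fastforce
      then have bdd: "bdd_above ?S" by (intro bdd_aboveI[of _ 1]) auto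
      have S0: "0 \<in> ?S" using y01 by simp
      have a_ge: "t \<le> a" if "G t \<le> y" for t
        using cSup_upper[of t ?S] bdd that by (simp add: a_def)
      have a_le: "G t \<le> y" if "t < a" for t
      proof -
        obtain s where "G s \<le> y" "t < s"
          using less_cSup_iff[of ?S t] S0 bdd \<open>t < a\<close> unfolding a_def by blast
        then show ?thesis using monoD[OF mG, of t s] by simp
      qed
      have a1: "a \<le> 1" unfolding a_def using S0 Sub by (intro cSup_least) auto
      have a0: "0 \<le> a" using a_ge S0 by simp
      have yGa: "y \<le> G a"
      proof (rule tendsto_lowerbound)
        show "(G \<longlongrightarrow> G a) (at_right a)"
          using is_liftD(3)[OF G, of a] by (simp add: continuous_within)
        have "y \<le> G t" if "t > a" for t using a_ge[of t] that by fastforce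
        then show "\<forall>\<^sub>F t in at_right a. y \<le> G t" by (auto simp: eventually_at_filter)
      qed simp
      have lay: "?l a \<le> y"
      proof (rule tendsto_upperbound[OF mono_Lim_at_left[OF mG]])
        show "\<forall>\<^sub>F t in at_left a. G t \<le> y" using a_le by (auto simp: eventually_at_filter)
      qed simp
      have "a \<noteq> 0" using yGa y y01 by auto
      then have apos: "a \<in> {0<..1}" using a0 a1 by simp
      have g1: "grid n (I n) \<le> a" for n using I a_ge by blast
      have g2: "a \<le> grid n (Suc (I n))" for n
        using I a_le by (meson linorder_not_le)
      note lims = grid_squeeze[OF g1 g2]
      have right: "(\<lambda>n. G (grid n (Suc (I n)))) \<longlonglongrightarrow> G a"
        using lift_tendsto_from_right[OF G g2 lims(2)] .
      have lt: "G (grid n (I n)) < G (grid n (Suc (I n)))" for n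
        using I by (meson le_less_trans)
      show "(\<lambda>n. q (G (grid n (I n))) (G (grid n (Suc (I n))))
          / (G (grid n (Suc (I n))) - G (grid n (I n)))) \<longlonglongrightarrow> F y"
      proof (cases "a \<in> J")
        case True
        then have ya: "?l a < y" "y < G a" using lay yGa y by (auto simp: less_le)
        have Fy: "F y = c a" using F(2)[OF True] ya by (simp add: U_def)
        \<comment> \<open>The left grid points stay strictly below \<open>a\<close>, since
          \<open>G\<close> has already exceeded \<open>y\<close> at \<open>a\<close>; hence
          \<open>G\<close> there tends to the left limit.\<close>
        have "grid n (I n) \<noteq> a" for n using I ya by (metis linorder_not_le)
        then have "grid n (I n) < a" for n using g1 by (simp add: less_le)
        then have "filterlim (\<lambda>n. grid n (I n)) (at_left a) sequentially"
          using lims(1) by (simp add: filterlim_at less_imp_neq)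
        then have left: "(\<lambda>n. G (grid n (I n))) \<longlonglongrightarrow> ?l a"
          using mono_Lim_at_left[OF mG] filterlim_compose by blast
        show ?thesis unfolding Fy c_def
          using left right ya lt by (intro tendsto_divide tendsto_diff q_tendsto) auto
      next
        case False
        \<comment> \<open>Without a jump the level \<open>y\<close> equals \<open>G a\<close> and
          lies in no gap, so \<open>F y = 0\<close> matches the limit given by
          \<open>q_little_o\<close>.\<close>
        then have eq: "?l a = G a" using apos le[of a] by (auto simp: J_def)
        then have c: "isCont G a" using lift_isCont_iff_Lim[OF G] by blast
        have "y \<notin> U b" if "b \<in> J" for b
        proof -
          have "b \<noteq> a" using that False by auto
          then show ?thesis using ge[of a b] ge[of b a] eq lay yGa
            by (cases "a < b") (auto simp: U_def)
        qed
        then have Fy: "F y = 0" using F(3) by blast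
        have left: "(\<lambda>n. G (grid n (I n))) \<longlonglongrightarrow> G a"
          using isCont_tendsto_compose[OF c lims(1)] .
        show ?thesis unfolding Fy by (rule q_little_o[OF lt left right])
      qed
    qed
  qed (use m F(1) in auto)
  \<comment> \<open>Also true for an empty cell \<open>x = y\<close>, because
    \<open>q x x = 0\<close>.\<close>
  moreover have "q x y / (y - x) * (y - x) = q x y" for x y by (cases "x = y") auto
  moreover have "indicator {G 0..<G 1} y * F y = F y" for y
  proof (cases "y \<in> {G 0..<G 1}")
    case False
    then have "y \<notin> \<Union>(U ` J)" using Usub by blast
    then show ?thesis using F(3) by simp
  qed simp
  ultimately have lim: "(\<lambda>n. \<Sum>i<2 ^ n. q (G (grid n i)) (G (grid n (Suc i)))) \<longlonglongrightarrow> integral\<^sup>L lborel F"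
    by simp
  have "c a * measure lborel (U a) = q (?l a) (G a)" if "a \<in> J" for a
    using that by (simp add: c_def U_def J_def)
  then have "((\<lambda>a. q (?l a) (G a)) has_sum integral\<^sup>L lborel F) J"
    using F(4) by (simp cong: has_sum_cong)
  \<comment> \<open>Exchanging 0 for 1 matches the two index sets; the terms agree because
    \<open>q\<close> is invariant under integer shifts.\<close>
  moreover have "((\<lambda>a. q (?l a) (G a)) has_sum x) (jumps G) \<longleftrightarrow> ((\<lambda>a. q (?l a) (G a)) has_sum x) J" for x
  proof (rule has_sum_reindex_bij_witness[where i = "\<lambda>b. if b = 1 then 0 else b" and j = "\<lambda>a. if a = 0 then 1 else a"])
    have l1: "?l 1 = ?l 0 + 1" using lift_Lim_add_1[OF G, of 0] by simp
    have G1: "G 1 = G 0 + 1" using is_liftD(2)[OF G, of 0] by simp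
    show "(if a = 0 then 1 else a) \<in> J" if "a \<in> jumps G" for a
      using that l1 G1 by (auto simp: J_def jumps_def)
    show "(if b = 1 then 0 else b) \<in> jumps G" if "b \<in> J" for b
      using that l1 G1 by (auto simp: J_def jumps_def)
    show "q (?l (if a = 0 then 1 else a)) (G (if a = 0 then 1 else a)) = q (?l a) (G a)" for a
      using l1 G1 q_shift[of "?l 0" 1 "G 0"] by simp
  qed (auto simp: J_def jumps_def)
  ultimately have "((\<lambda>a. q (?l a) (G a)) has_sum integral\<^sup>L lborel F) (jumps G)" by blast
  from infsumI[OF this] lim show ?thesis by simp
qed

end

subsection \<open>Arcs under circle homeomorphisms\<close>

lemma frac_lift_frac:
  fixes g :: "real \<Rightarrow> real"
  assumes "\<And>x. g (x + 1) = g x + 1"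
  shows "frac (g (frac x)) = frac (g x)"
  using lift_frac[of g x] assms by (simp add: frac_def)

lemma arc_nonneg [simp]: "arc x y \<ge> 0"
  by (simp add: arc_def)

lemma arc_lt_1 [simp]: "arc x y < 1"
  by (simp add: arc_def frac_lt_1)

lemma arc_self [simp]: "arc x x = 0"
  by (simp add: arc_def frac_def)

lemma add_arc: "x + arc x y = y + of_int (- \<lfloor>y - x\<rfloor>)"
  by (simp add: arc_def frac_def)

lemma frac_eqI:
  fixes x y :: real
  assumes "y = x + of_int k" "0 \<le> x" "x < 1"
  shows "frac y = x"
  using assms by (simp add: frac_def floor_unique)

lemma arc_frac: "arc (frac x) (frac y) = frac (y - x)"
proof -
  have "frac y - frac x = (y - x) + of_int (\<lfloor>x\<rfloor> - \<lfloor>y\<rfloor>)" by (simp add: frac_def)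
  then show ?thesis unfolding arc_def by (metis frac_def add_diff_cancel_right floor_add_int of_int_add add_diff_add)
qed

text \<open>\<open>x + arc x y\<close> is the representative of \<open>y\<close> in [x, x + 1), and
  \<open>g\<close> maps that interval into [g x, g x + 1); the difference is thus already a
  fractional part.\<close>

lemma arc_lift:
  assumes per: "\<And>x. g (x + 1) = g x + (1::real)" and mono: "strict_mono g"
  shows "arc (frac (g x)) (frac (g y)) = g (x + arc x y) - g x"
proof -
  have "g (x + arc x y) = g y + of_int (- \<lfloor>y - x\<rfloor>)"
    unfolding add_arc using lift_add_int[of g] per by blast
  moreover have "g x \<le> g (x + arc x y)" "g (x + arc x y) < g (x + 1)"
    using mono by (simp_all add: strict_mono_less_eq strict_mono_less)
  ultimately show ?thesis
    unfolding arc_frac by (intro frac_eqI[where k = "\<lfloor>y - x\<rfloor>"]) (auto simp: per)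
qed

text \<open>Shows that circle homeomorphisms preserve the support of the marginals. Partial sums of
  the arcs unroll the family to the line and end one period after their start, so the image arcs
  telescope to \<open>g (y 0 + 1) - g (y 0) = 1\<close>.\<close>

lemma sum_arc_lift:
  assumes per: "\<And>x. g (x + 1) = g x + (1::real)" and mono: "strict_mono g"
    and sum1: "(\<Sum>i<N. arc (x i) (x (Suc i mod N))) = 1"
  shows "(\<Sum>i<N. arc (frac (g (x i))) (frac (g (x (Suc i mod N))))) = 1"
proof -
  define y where "y j = x 0 + (\<Sum>i<j. arc (x i) (x (Suc i mod N)))" for j
  have y_int: "\<exists>k::int. y j = x j + of_int k" if "j < N" for j
    using that
  proof (induction j)
    case (Suc j)
    then obtain k :: int where k: "y j = x j + of_int k" by auto
    have "y (Suc j) = x j + arc (x j) (x (Suc j)) + of_int k" using k Suc.prems by (simp add: y_def)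
    also have "\<dots> = x (Suc j) + of_int (- \<lfloor>x (Suc j) - x j\<rfloor> + k)" unfolding add_arc by simp
    finally show ?case by blast
  qed (auto simp: y_def intro: exI[of _ 0])
  have "arc (frac (g (x i))) (frac (g (x (Suc i mod N)))) = g (y (Suc i)) - g (y i)" if i: "i < N" for i
  proof -
    obtain k :: int where k: "y i = x i + of_int k" using y_int[OF i] by blast
    have "y (Suc i) = x i + arc (x i) (x (Suc i mod N)) + of_int k" using k by (simp add: y_def)
    then show ?thesis
      using k lift_add_int[of g _ k] per arc_lift[OF per mono] by simp
  qed
  then have "(\<Sum>i<N. arc (frac (g (x i))) (frac (g (x (Suc i mod N))))) = (\<Sum>i<N. g (y (Suc i)) - g (y i))"
    by simp
  also have "\<dots> = g (y N) - g (y 0)" by (rule sum_lessThan_telescope)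
  also have "\<dots> = 1" using sum1 per by (simp add: y_def)
  finally show ?thesis .
qed

text \<open>Allows the Jacobian factor at a grid point to be shared by the two intervals meeting
  there.\<close>

lemma sum_cyclic:
  fixes a :: "nat \<Rightarrow> real"
  shows "(\<Sum>i<N. a (Suc i mod N)) = (\<Sum>i<N. a i)"
proof (cases N)
  case (Suc M)
  have "(\<Sum>i<N. a (Suc i mod N)) = (\<Sum>i<M. a (Suc i mod Suc M)) + a 0" by (simp add: Suc)
  also have "(\<Sum>i<M. a (Suc i mod Suc M)) = (\<Sum>i<M. a (Suc i))" by (intro sum.cong) auto
  also have "\<dots> + a 0 = (\<Sum>i<N. a i)" using sum.lessThan_Suc_shift[of a M] by (simp add: Suc del: sum.lessThan_Suc)
  finally show ?thesis .
qed simp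

subsection \<open>Change of variables on the torus\<close>

lemma frac_measurable [measurable]: "(frac :: real \<Rightarrow> real) \<in> borel_measurable borel"
  unfolding frac_def[abs_def] by measurable

text \<open>Every fundamental domain of the circle carries the same integral. It is needed because
  the image of the unit interval under \<open>H\<close> starts at \<open>H 0\<close>, which need not
  be an integer.\<close>

lemma nn_integral_frac_period:
  fixes F :: "real \<Rightarrow> ennreal"
  assumes [measurable]: "F \<in> borel_measurable borel"
  shows "(\<integral>\<^sup>+y. F (frac y) * indicator {c..<c + 1} y \<partial>lborel) = (\<integral>\<^sup>+y. F y * indicator {0..<1} y \<partial>lborel)"
proof -
  define r where "r = frac c"
  have r: "0 \<le> r" "r < 1" by (auto simp: r_def frac_lt_1)
  have c: "c = r + of_int \<lfloor>c\<rfloor>" by (simp add: r_def frac_def)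
  have "(\<integral>\<^sup>+y. F (frac y) * indicator {c..<c + 1} y \<partial>lborel)
      = (\<integral>\<^sup>+y. F (frac (of_int \<lfloor>c\<rfloor> + 1 * y)) * indicator {c..<c + 1} (of_int \<lfloor>c\<rfloor> + 1 * y) \<partial>lborel)"
    by (subst nn_integral_real_affine[where c = 1 and t = "of_int \<lfloor>c\<rfloor>"]) auto
  \<comment> \<open>After an integer shift the domain is [r, r + 1); it is cut at 1 and the upper
    piece is moved back by one period.\<close>
  also have "\<dots> = (\<integral>\<^sup>+y. F y * indicator {r..<1} y + F (y - 1) * indicator {1..<r + 1} y \<partial>lborel)"
  proof (intro nn_integral_cong)
    fix y
    have ind: "indicator {c..<c + 1} (of_int \<lfloor>c\<rfloor> + 1 * y) = (indicator {r..<r + 1} y :: ennreal)"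
      using c by (auto simp: indicator_def)
    have fr: "frac (of_int \<lfloor>c\<rfloor> + 1 * y) = frac y"
      by (simp add: frac_def)
    consider "r \<le> y \<and> y < 1" | "1 \<le> y \<and> y < r + 1" | "y < r \<or> y \<ge> r + 1" by linarith
    then show "F (frac (of_int \<lfloor>c\<rfloor> + 1 * y)) * indicator {c..<c + 1} (of_int \<lfloor>c\<rfloor> + 1 * y)
        = F y * indicator {r..<1} y + F (y - 1) * indicator {1..<r + 1} y"
      unfolding ind fr
    proof cases
      case 1
      then show "F (frac y) * indicator {r..<r + 1} y
        = F y * indicator {r..<1} y + F (y - 1) * indicator {1..<r + 1} y"
        using r frac_eqI[of y y 0] by simp
    next
      case 2
      then show "F (frac y) * indicator {r..<r + 1} y
        = F y * indicator {r..<1} y + F (y - 1) * indicator {1..<r + 1} y"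
        using r frac_eqI[of y "y - 1" 1] by simp
    next
      case 3
      then show "F (frac y) * indicator {r..<r + 1} y
        = F y * indicator {r..<1} y + F (y - 1) * indicator {1..<r + 1} y"
        using r by (auto simp: indicator_def)
    qed
  qed
  also have "\<dots> = (\<integral>\<^sup>+y. F y * indicator {r..<1} y \<partial>lborel) + (\<integral>\<^sup>+y. F (y - 1) * indicator {1..<r + 1} y \<partial>lborel)"
    by (intro nn_integral_add) auto
  also have "(\<integral>\<^sup>+y. F (y - 1) * indicator {1..<r + 1} y \<partial>lborel) = (\<integral>\<^sup>+y. F y * indicator {0..<r} y \<partial>lborel)"
    by (subst nn_integral_real_affine[where c = 1 and t = 1]) (auto intro!: nn_integral_cong simp: indicator_def)
  also have "(\<integral>\<^sup>+y. F y * indicator {r..<1} y \<partial>lborel) + (\<integral>\<^sup>+y. F y * indicator {0..<r} y \<partial>lborel)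
      = (\<integral>\<^sup>+y. F y * indicator {r..<1} y + F y * indicator {0..<r} y \<partial>lborel)"
    by (intro nn_integral_add[symmetric]) auto
  also have "\<dots> = (\<integral>\<^sup>+y. F y * indicator {0..<1} y \<partial>lborel)"
    using r by (intro nn_integral_cong) (auto simp: indicator_def)
  finally show ?thesis .
qed

text \<open>Both measures agree on boxes, where the integral factorises. Sigma-finiteness of the
  weighted factors is a separate hypothesis because densities with infinite values can destroy
  it.\<close>

lemma PiM_density:
  assumes "finite I" and M: "product_sigma_finite M" and D: "product_sigma_finite (\<lambda>i. density (M i) (g i))"
    and g [measurable]: "\<And>i. g i \<in> borel_measurable (M i)"
  shows "PiM I (\<lambda>i. density (M i) (g i)) = density (PiM I M) (\<lambda>x. \<Prod>i\<in>I. g i (x i))"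
proof -
  interpret M: product_sigma_finite M by fact
  interpret D: product_sigma_finite "\<lambda>i. density (M i) (g i)" by fact
  have [measurable]: "(\<lambda>x. \<Prod>i\<in>I. g i (x i)) \<in> borel_measurable (PiM I M)"
    by measurable
  show ?thesis
  proof (rule D.PiM_eqI[symmetric, OF \<open>finite I\<close>])
    show "sets (density (PiM I M) (\<lambda>x. \<Prod>i\<in>I. g i (x i))) = sets (PiM I (\<lambda>i. density (M i) (g i)))"
      by (simp cong: sets_PiM_cong)
    fix A assume "\<And>i. i \<in> I \<Longrightarrow> A i \<in> sets (density (M i) (g i))"
    then have A: "\<And>i. i \<in> I \<Longrightarrow> A i \<in> sets (M i)" by simp
    have [measurable]: "PiE I A \<in> sets (PiM I M)" using A \<open>finite I\<close> by (intro sets_PiM_I_finite) auto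
    have "emeasure (density (PiM I M) (\<lambda>x. \<Prod>i\<in>I. g i (x i))) (PiE I A)
        = (\<integral>\<^sup>+x. (\<Prod>i\<in>I. g i (x i)) * indicator (PiE I A) x \<partial>PiM I M)"
      by (intro emeasure_density) measurable
    also have "\<dots> = (\<integral>\<^sup>+x. (\<Prod>i\<in>I. g i (x i) * indicator (A i) (x i)) \<partial>PiM I M)"
    proof (intro nn_integral_cong)
      fix x assume "x \<in> space (PiM I M)"
      then have "x \<in> extensional I" by (auto simp: space_PiM PiE_def)
      then have "indicator (PiE I A) x = (\<Prod>i\<in>I. indicator (A i) (x i) :: ennreal)"
        using \<open>finite I\<close> by (auto simp: indicator_def PiE_iff prod_zero_iff)
      then show "(\<Prod>i\<in>I. g i (x i)) * indicator (PiE I A) x = (\<Prod>i\<in>I. g i (x i) * indicator (A i) (x i))"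
        by (simp add: prod.distrib)
    qed
    also have "\<dots> = (\<Prod>i\<in>I. \<integral>\<^sup>+x. g i x * indicator (A i) x \<partial>M i)"
      using \<open>finite I\<close> A by (intro M.product_nn_integral_prod) auto
    also have "\<dots> = (\<Prod>i\<in>I. emeasure (density (M i) (g i)) (A i))"
      using A by (intro prod.cong) (auto simp: emeasure_density)
    finally show "emeasure (density (PiM I M) (\<lambda>x. \<Prod>i\<in>I. g i (x i))) (PiE I A)
      = (\<Prod>i\<in>I. emeasure (density (M i) (g i)) (A i))" .
  qed
qed

context circle_diffeo
begin

section \<open>The inverse circle map, and substitution in one and several variables\<close>

lemma strict_mono_H: "strict_mono H"
  using H_mono by (simp add: strict_mono_def)

lemma surj_H: "surj H"
  unfolding surj_def
proof
  fix y
  define k where "k = \<lfloor>y - H 0\<rfloor>"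
  have "H (of_int k) = H 0 + of_int k" "H (of_int (k + 1)) = H 0 + of_int (k + 1)"
    using lift_add_int[of H 0] H_per by (metis add_0)+
  moreover have "of_int k \<le> y - H 0" "y - H 0 < of_int k + 1" unfolding k_def by linarith+
  ultimately have "H (of_int k) \<le> y" "y \<le> H (of_int (k + 1))" by simp_all
  then have "\<exists>x. of_int k \<le> x \<and> x \<le> of_int (k + 1) \<and> H x = y"
    using cont_H by (intro IVT) auto
  then show "\<exists>x. y = H x" by blast
qed

definition K :: "real \<Rightarrow> real" where "K = inv H"

lemma K_H [simp]: "K (H x) = x"
  unfolding K_def using strict_mono_imp_inj_on[OF strict_mono_H] by (rule inv_f_f)

lemma H_K [simp]: "H (K x) = x"
  unfolding K_def using surj_H by (rule surj_f_inv_f)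

lemma strict_mono_K: "strict_mono K"
  unfolding strict_mono_def using H_less_iff by (metis H_K)

lemma K_per: "K (x + 1) = K x + 1"
  using H_per[of "K x"] K_H by (metis H_K)

lemma cont_K: "isCont K x"
  using isCont_inverse_function[of 1 "K x" K H] cont_H by simp

lemma K_measurable [measurable]: "K \<in> borel_measurable borel"
  using strict_mono_K by (intro borel_measurable_mono strict_mono_mono)

definition h :: "real \<Rightarrow> real" where "h x = frac (H x)"
definition hinv :: "real \<Rightarrow> real" where "hinv x = frac (K x)"

lemma h_measurable [measurable]: "h \<in> borel_measurable borel"
  unfolding h_def[abs_def] by measurable

lemma hinv_measurable [measurable]: "hinv \<in> borel_measurable borel"
  unfolding hinv_def[abs_def] by measurable

lemma hinv_h: "hinv (h x) = frac x"
  unfolding h_def hinv_def using frac_lift_frac[of K "H x"] K_per by simp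

lemma h_hinv: "h (hinv x) = frac x"
  unfolding h_def hinv_def using frac_lift_frac[of H "K x"] H_per by simp

text \<open>Substitution is carried out for the lift, and the resulting fundamental domain is moved
  back to [0,1).\<close>

lemma nn_integral_h:
  fixes F :: "real \<Rightarrow> ennreal"
  assumes [measurable]: "F \<in> borel_measurable borel"
  shows "(\<integral>\<^sup>+x. F (h x) * (indicator {0..<1} x * ennreal (f x)) \<partial>lborel) = (\<integral>\<^sup>+x. F x * indicator {0..<1} x \<partial>lborel)"
proof -
  \<comment> \<open>The substitution rule is stated for closed intervals; these two endpoints
    account for the difference to half-open ones.\<close>
  have AE: "AE x in lborel. x \<noteq> (1::real)" "AE x in lborel. x \<noteq> H 1"
    by (rule AE_lborel_singleton)+
  have "(\<integral>\<^sup>+x. F (h x) * (indicator {0..<1} x * ennreal (f x)) \<partial>lborel)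
      = (\<integral>\<^sup>+x. F (frac (H x)) * ennreal (f x) * indicator {0..1} x \<partial>lborel)"
    using AE(1) by (intro nn_integral_cong_AE) (auto simp: h_def indicator_def ac_simps elim!: eventually_mono)
  also have "\<dots> = (\<integral>\<^sup>+y. F (frac y) * indicator {H 0..H 1} y \<partial>lborel)"
    using deriv_H f_pos cont_f
    by (intro nn_integral_substitution_aux[symmetric]) (auto simp: less_imp_le continuous_at_imp_continuous_on)
  also have "\<dots> = (\<integral>\<^sup>+y. F (frac y) * indicator {H 0..<H 0 + 1} y \<partial>lborel)"
    using AE(2) H_per[of 0] by (intro nn_integral_cong_AE) (auto simp: indicator_def elim!: eventually_mono)
  also have "\<dots> = (\<integral>\<^sup>+x. F x * indicator {0..<1} x \<partial>lborel)"
    by (intro nn_integral_frac_period) simp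
  finally show ?thesis .
qed

text \<open>Restricted to [0,1), Lebesgue measure and its version weighted by \<open>f\<close> are
  probability measures, and \<open>h\<close> pushes the second to the first. Images of finite
  products of probability measures are taken coordinatewise, so no multidimensional Jacobian is
  needed.\<close>

lemma nn_integral_PiM_h:
  fixes W :: "(nat \<Rightarrow> real) \<Rightarrow> ennreal"
  assumes [measurable]: "W \<in> borel_measurable (PiM {..<N} (\<lambda>_. lborel))"
  shows "(\<integral>\<^sup>+x. W x * (\<Prod>i<N. indicator {0..<1} (x i)) \<partial>PiM {..<N} (\<lambda>_. lborel))
    = (\<integral>\<^sup>+x. W (\<lambda>i\<in>{..<N}. h (x i)) * (\<Prod>i<N. indicator {0..<1} (x i) * ennreal (f (x i))) \<partial>PiM {..<N} (\<lambda>_. lborel))"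
proof -
  define M0 :: "real measure" where "M0 = density lborel (indicator {0..<1})"
  define M1 where "M1 = density lborel (\<lambda>x. indicator {0..<1} x * ennreal (f x))"
  have [simp]: "sets M0 = sets borel" "sets M1 = sets borel" "space M0 = UNIV" "space M1 = UNIV"
    by (auto simp: M0_def M1_def)
  have hm [measurable]: "h \<in> M1 \<rightarrow>\<^sub>M M0" by (simp cong: measurable_cong_sets)
  have "distr M1 M0 h = M0"
  proof (rule measure_eqI)
    fix A assume "A \<in> sets (distr M1 M0 h)"
    then have [measurable]: "A \<in> sets borel" by simp
    have [measurable]: "h -` A \<in> sets borel" using measurable_sets[OF h_measurable, of A] by simp
    have "emeasure (distr M1 M0 h) A = emeasure M1 (h -` A)"
      by (subst emeasure_distr[OF hm]) auto
    also have "\<dots> = (\<integral>\<^sup>+x. indicator A (h x) * (indicator {0..<1} x * ennreal (f x)) \<partial>lborel)"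
      unfolding M1_def by (subst emeasure_density) (auto intro!: nn_integral_cong simp: indicator_def)
    also have "\<dots> = (\<integral>\<^sup>+x. indicator A x * indicator {0..<1} x \<partial>lborel)"
      by (rule nn_integral_h) simp
    also have "\<dots> = emeasure M0 A"
      unfolding M0_def by (subst emeasure_density) (auto intro!: nn_integral_cong simp: indicator_def)
    finally show "emeasure (distr M1 M0 h) A = emeasure M0 A" .
  qed simp
  have p0: "prob_space M0"
    by (rule prob_spaceI) (simp add: M0_def emeasure_density)
  have p1: "prob_space M1"
  proof (rule prob_spaceI)
    show "emeasure M1 (space M1) = 1"
      using nn_integral_h[of "\<lambda>_. 1"] by (simp add: M1_def emeasure_density)
  qed
  interpret M0: product_prob_space "\<lambda>_::nat. M0" by (intro product_prob_spaceI p0)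
  interpret M1: product_prob_space "\<lambda>_::nat. M1" by (intro product_prob_spaceI p1)
  interpret L: product_sigma_finite "\<lambda>_::nat. lborel :: real measure" ..
  have P0: "PiM {..<N} (\<lambda>_. M0) = density (PiM {..<N} (\<lambda>_. lborel)) (\<lambda>x. \<Prod>i<N. indicator {0..<1} (x i))"
    unfolding M0_def
    by (rule PiM_density) (use L.product_sigma_finite_axioms M0.product_sigma_finite_axioms in \<open>auto simp: M0_def\<close>)
  have P1: "PiM {..<N} (\<lambda>_. M1)
      = density (PiM {..<N} (\<lambda>_. lborel)) (\<lambda>x. \<Prod>i<N. indicator {0..<1} (x i) * ennreal (f (x i)))"
    unfolding M1_def
    by (rule PiM_density) (use L.product_sigma_finite_axioms M1.product_sigma_finite_axioms in \<open>auto simp: M1_def\<close>)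
  have D: "distr (PiM {..<N} (\<lambda>_. M1)) (PiM {..<N} (\<lambda>_. M0)) (compose {..<N} h) = PiM {..<N} (\<lambda>_. M0)"
    using distr_PiM_finite_prob_space'[of "{..<N}" "\<lambda>_. M1" "\<lambda>_. M0" h] p0 p1 \<open>distr M1 M0 h = M0\<close> by simp
  have sP: "sets (PiM {..<N} (\<lambda>_. M0)) = sets (PiM {..<N} (\<lambda>_. lborel))"
    "sets (PiM {..<N} (\<lambda>_. M1)) = sets (PiM {..<N} (\<lambda>_. lborel))"
    by (auto intro!: sets_PiM_cong)
  have cm: "compose {..<N} h \<in> PiM {..<N} (\<lambda>_. M1) \<rightarrow>\<^sub>M PiM {..<N} (\<lambda>_. M0)"
    unfolding compose_def by measurable
  have cm' [measurable]: "compose {..<N} h \<in> PiM {..<N} (\<lambda>_. lborel) \<rightarrow>\<^sub>M PiM {..<N} (\<lambda>_. lborel)"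
    unfolding compose_def by measurable
  have Wm: "W \<in> borel_measurable (PiM {..<N} (\<lambda>_. M0))"
    using assms measurable_cong_sets[OF sP(1) refl] by blast
  have "(\<integral>\<^sup>+x. W x * (\<Prod>i<N. indicator {0..<1} (x i)) \<partial>PiM {..<N} (\<lambda>_. lborel))
      = integral\<^sup>N (PiM {..<N} (\<lambda>_. M0)) W"
    unfolding P0 by (subst nn_integral_density) (auto simp: mult.commute)
  also have "\<dots> = (\<integral>\<^sup>+x. W (compose {..<N} h x) \<partial>PiM {..<N} (\<lambda>_. M1))"
    by (subst D[symmetric], rule nn_integral_distr[OF cm]) (use Wm in simp)
  also have "\<dots> = (\<integral>\<^sup>+x. W (compose {..<N} h x) * (\<Prod>i<N. indicator {0..<1} (x i) * ennreal (f (x i))) \<partial>PiM {..<N} (\<lambda>_. lborel))"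
    unfolding P1 by (subst nn_integral_density) (auto simp: mult.commute)
  finally show ?thesis by (simp add: compose_def)
qed

end

subsection \<open>The density of finite-dimensional marginals\<close>

lemma arc_measurable [measurable (raw)]:
  assumes [measurable]: "u \<in> borel_measurable M" "v \<in> borel_measurable M"
  shows "(\<lambda>x. arc (u x) (v x)) \<in> borel_measurable M"
  unfolding arc_def by measurable

lemma dir_support_sets [measurable]: "dir_support N \<in> sets (PiM {..<N} (\<lambda>_. lborel))"
proof (cases "N = 0")
  case True
  \<comment> \<open>The empty sum is not 1, so the set is empty. The case is split off because
    \<open>Suc i mod 0\<close> would leave the index set.\<close>
  then show ?thesis by (simp add: dir_support_def)
next
  case False
  then have Suc_mod: "Suc i mod N \<in> {..<N}" for i by simp
  have [measurable]: "PiE {..<N} (\<lambda>_. {0..<1::real}) \<in> sets (PiM {..<N} (\<lambda>_. lborel))"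
    by (intro sets_PiM_I_finite) auto
  have [measurable]: "(\<lambda>x. x (Suc i mod N)) \<in> PiM {..<N} (\<lambda>_. lborel :: real measure) \<rightarrow>\<^sub>M borel" for i
    using measurable_component_singleton[OF Suc_mod[of i], of "\<lambda>_. lborel :: real measure"] by simp
  have [measurable]: "(\<lambda>x. x i) \<in> PiM {..<N} (\<lambda>_. lborel :: real measure) \<rightarrow>\<^sub>M borel" if "i \<in> {..<N}" for i
    using measurable_component_singleton[OF that, of "\<lambda>_. lborel :: real measure"] by simp
  have [measurable]: "(\<lambda>x. \<Sum>i<N. arc (x i) (x (Suc i mod N))) \<in> borel_measurable (PiM {..<N} (\<lambda>_. lborel))"
    by (intro borel_measurable_sum arc_measurable) measurable
  have "dir_support N = {x \<in> space (PiM {..<N} (\<lambda>_. lborel)). x \<in> PiE {..<N} (\<lambda>_. {0..<1})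
      \<and> (\<Sum>i<N. arc (x i) (x (Suc i mod N))) = 1}"
    by (auto simp: dir_support_def space_PiM PiE_def)
  also have "\<dots> \<in> sets (PiM {..<N} (\<lambda>_. lborel))" by measurable
  finally show ?thesis .
qed

lemma dir_density_measurable [measurable]:
  "dir_density \<beta> N t \<in> borel_measurable (PiM {..<N} (\<lambda>_. lborel))"
proof -
  have [measurable]: "(\<lambda>x. x (Suc i mod N)) \<in> PiM {..<N} (\<lambda>_. lborel :: real measure) \<rightarrow>\<^sub>M borel" if "i \<in> {..<N}" for i
    using measurable_component_singleton[of "Suc i mod N" "{..<N}" "\<lambda>_. lborel :: real measure"] that by simp
  have [measurable]: "(\<lambda>x. x i) \<in> PiM {..<N} (\<lambda>_. lborel :: real measure) \<rightarrow>\<^sub>M borel" if "i \<in> {..<N}" for i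
    using measurable_component_singleton[OF that, of "\<lambda>_. lborel :: real measure"] by simp
  show ?thesis unfolding dir_density_def[abs_def]
    by (intro borel_measurable_times borel_measurable_const borel_measurable_prod powr_real_measurable arc_measurable) measurable
qed

text \<open>Level 0 is excluded because its single arc is the whole circle, which \<open>arc\<close>
  reports as 0. At the last index the arc wraps around, hence the shift by -1.\<close>

lemma arc_grid:
  assumes "n > 0" "i < 2 ^ n"
  shows "arc (grid n i) (grid n (Suc i mod 2 ^ n)) = 1 / 2 ^ n"
proof -
  have n: "(1::real) < 2 ^ n" using assms(1) by simp
  show ?thesis
  proof (cases "Suc i < 2 ^ n")
    case True
    then show ?thesis unfolding arc_def using grid_diff[of n i] n by (simp add: frac_eq)
  next
    case False
    then have i: "Suc i = 2 ^ n" using assms(2) by simp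
    have "grid n 0 - grid n i = 1 / 2 ^ n + of_int (-1)"
      using grid_diff[of n i] unfolding i by simp
    then show ?thesis unfolding arc_def i using n by (intro frac_eqI[where k = "-1"]) auto
  qed
qed

lemma sum_arc_grid:
  assumes "n > 0"
  shows "(\<Sum>i<2 ^ n. arc (grid n i) (grid n (Suc i mod 2 ^ n))) = 1"
  using arc_grid[OF assms] by simp

context circle_diffeo
begin

lemma slope_measurable [measurable (raw)]:
  assumes [measurable]: "u \<in> borel_measurable M" "v \<in> borel_measurable M"
  shows "(\<lambda>x. slope (u x) (v x)) \<in> borel_measurable M"
  unfolding slope_def by measurable

text \<open>The logarithm of the factor which an increment from c to c + d contributes to the density
  of the marginal on the dyadic grid of level n.\<close>
definition incr :: "real \<Rightarrow> nat \<Rightarrow> real \<Rightarrow> real \<Rightarrow> real" where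
  "incr \<beta> n c d = q c (c + d) + \<beta> / 2 ^ n * ln (slope c (c + d))"

text \<open>If x is constant, then x are the values of a map whose lift has a single increment 1 on the
  grid, which the arcs between the points do not see.\<close>
definition grid_dens :: "real \<Rightarrow> nat \<Rightarrow> (nat \<Rightarrow> real) \<Rightarrow> real" where
  "grid_dens \<beta> n x = exp (if \<forall>i<2 ^ n. x i = x 0 then incr \<beta> n (x 0) 1 + (2 ^ n - 1) * incr \<beta> n (x 0) 0
     else \<Sum>i<2 ^ n. incr \<beta> n (x i) (arc (x i) (x (Suc i mod 2 ^ n))))"

lemma incr_measurable [measurable (raw)]:
  assumes [measurable]: "u \<in> borel_measurable M" "v \<in> borel_measurable M"
  shows "(\<lambda>x. incr \<beta> n (u x) (v x)) \<in> borel_measurable M"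
  unfolding incr_def q_def by measurable

lemma grid_dens_measurable [measurable (raw)]:
  assumes [measurable]: "\<And>i. i < 2 ^ n \<Longrightarrow> (\<lambda>x. u x i) \<in> borel_measurable M"
  shows "(\<lambda>x. grid_dens \<beta> n (u x)) \<in> borel_measurable M"
proof -
  have [measurable]: "(\<lambda>x. u x 0) \<in> borel_measurable M" by (rule assms) simp
  have 1: "Measurable.pred M (\<lambda>x. \<forall>i<2 ^ n. u x i = u x 0)"
  proof -
    have "Measurable.pred M (\<lambda>x. \<forall>i\<in>{..<2 ^ n}. u x i = u x 0)"
      using assms by (intro pred_intros_finite(3) borel_measurable_eq) auto
    then show ?thesis by (simp add: lessThan_def)
  qed
  have 2: "(\<lambda>x. \<Sum>i<2 ^ n. incr \<beta> n (u x i) (arc (u x i) (u x (Suc i mod 2 ^ n)))) \<in> borel_measurable M"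
    using assms by (intro borel_measurable_sum incr_measurable arc_measurable) auto
  show ?thesis unfolding grid_dens_def
    by (intro borel_measurable_exp[THEN measurable_compose[rotated]] measurable_If 1 2) measurable
qed

lemma incr_frac: "incr \<beta> n (frac c) d = incr \<beta> n c d"
proof -
  have "frac c = c + of_int (- \<lfloor>c\<rfloor>)" by (simp add: frac_def)
  moreover have "c + of_int k + d = (c + d) + of_int k" for k by simp
  ultimately show ?thesis unfolding incr_def by (metis q_shift slope_shift)
qed

text \<open>The increments of \<open>G\<close> over the grid are nonnegative with sum 1. Either all
  are below 1, and the arcs recover them, or one of them is 1 and the circle values are constant; in
  that case the position of the unit increment does not affect the sum.\<close>

lemma grid_dens_lift:
  assumes G: "is_lift G"
  shows "grid_dens \<beta> n (\<lambda>i\<in>{..<2 ^ n}. frac (G (grid n i))) =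
    exp ((\<Sum>i<2 ^ n. q (G (grid n i)) (G (grid n (Suc i))))
      + \<beta> * (\<Sum>i<2 ^ n. ln (slope (G (grid n i)) (G (grid n (Suc i)))) * (1 / 2 ^ n)))"
proof -
  define g where "g i = G (grid n i)" for i
  define d where "d i = g (Suc i) - g i" for i
  define x where "x = (\<lambda>i\<in>{..<2 ^ n}. frac (g i))"
  have x: "x i = frac (g i)" if "i < 2 ^ n" for i using that by (simp add: x_def)
  note mG = is_liftD(1)[OF G]
  have gN: "g (2 ^ n) = g 0 + 1" using is_liftD(2)[OF G, of 0] by (simp add: g_def)
  have gm: "g i \<le> g j" if "i \<le> j" for i j
    unfolding g_def using that by (intro monoD[OF mG]) (simp add: grid_def divide_right_mono)
  have d0: "d i \<ge> 0" for i using gm[of i "Suc i"] by (simp add: d_def)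
  have sumd: "(\<Sum>i<2 ^ n. d i) = 1"
    unfolding d_def using sum_lessThan_telescope[of g "2 ^ n"] gN by simp
  have rhs: "(\<Sum>i<2 ^ n. q (g i) (g (Suc i))) + \<beta> * (\<Sum>i<2 ^ n. ln (slope (g i) (g (Suc i))) * (1 / 2 ^ n))
      = (\<Sum>i<2 ^ n. incr \<beta> n (g i) (d i))"
    by (simp add: incr_def d_def sum_distrib_left sum.distrib[symmetric])
  have "(if \<forall>i<2 ^ n. x i = x 0 then incr \<beta> n (x 0) 1 + (2 ^ n - 1) * incr \<beta> n (x 0) 0
     else \<Sum>i<2 ^ n. incr \<beta> n (x i) (arc (x i) (x (Suc i mod 2 ^ n)))) = (\<Sum>i<2 ^ n. incr \<beta> n (g i) (d i))"
  proof (cases "\<forall>i<2 ^ n. x i = x 0")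
    case const: True
    have frg: "frac (g i) = x 0" if "i \<le> 2 ^ n" for i
    proof (cases "i < 2 ^ n")
      case True
      then have "x i = x 0" using const by blast
      then show ?thesis using x[OF True] by simp
    next
      case False
      then have "i = 2 ^ n" using that by simp
      then have "frac (g i) = frac (g 0)" using gN by (simp add: frac_def)
      then show ?thesis using x[of 0] by simp
    qed
    \<comment> \<open>Equal fractional parts make the increment an integer, and it is at most the
      total 1.\<close>
    have d01: "d i = 0 \<or> d i = 1" if "i < 2 ^ n" for i
    proof -
      have "frac (g (Suc i)) = frac (g i)" using frg[of i] frg[of "Suc i"] that by simp
      then have "d i = of_int (\<lfloor>g (Suc i)\<rfloor> - \<lfloor>g i\<rfloor>)" by (simp add: d_def frac_def)
      then obtain k :: int where k: "d i = of_int k" by blast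
      have "d i \<le> 1" using member_le_sum[of i "{..<2 ^ n}" d] d0 that sumd by simp
      then show ?thesis using k d0[of i] by (cases "k = 0") auto
    qed
    \<comment> \<open>On increments 0 and 1 the term agrees with an affine function of
      \<open>d i\<close>, so the sum depends on the total increment alone.\<close>
    have "incr \<beta> n (g i) (d i) = incr \<beta> n (x 0) 0 + d i * (incr \<beta> n (x 0) 1 - incr \<beta> n (x 0) 0)"
      if "i < 2 ^ n" for i
      using d01[OF that] incr_frac[of \<beta> n "g i" "d i"] frg[of i] that by auto
    then have "(\<Sum>i<2 ^ n. incr \<beta> n (g i) (d i))
        = (\<Sum>i<2 ^ n. incr \<beta> n (x 0) 0 + d i * (incr \<beta> n (x 0) 1 - incr \<beta> n (x 0) 0))" by simp
    also have "\<dots> = 2 ^ n * incr \<beta> n (x 0) 0 + (incr \<beta> n (x 0) 1 - incr \<beta> n (x 0) 0)"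
      using sumd by (simp add: sum.distrib sum_distrib_right[symmetric])
    finally show ?thesis unfolding if_P[OF const] by (simp add: algebra_simps)
  next
    case False
    \<comment> \<open>An increment of 1 uses up the whole period, so \<open>g\<close> is constant
      before and after it and all circle values coincide.\<close>
    have d1: "d i < 1" if i: "i < 2 ^ n" for i
    proof (rule ccontr)
      assume "\<not> d i < 1"
      then have "g (Suc i) \<ge> g i + 1" by (simp add: d_def)
      moreover have "g 0 \<le> g i" "g (Suc i) \<le> g 0 + 1" using gm[of 0 i] gm[of "Suc i" "2 ^ n"] i gN by auto
      ultimately have e: "g i = g 0" "g (Suc i) = g 0 + 1" by simp_all
      have "x j = x 0" if j: "j < 2 ^ n" for j
      proof (cases "j \<le> i")
        case True
        then have "g j = g 0" using gm[of 0 j] gm[of j i] e by simp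
        then show ?thesis using x[OF j] x[of 0] by simp
      next
        case False
        then have "g j = g 0 + 1" using gm[of "Suc i" j] gm[of j "2 ^ n"] e gN j by simp
        then have "frac (g j) = frac (g 0)" by (simp add: frac_def)
        then show ?thesis using x[OF j] x[of 0] by simp
      qed
      then show False using False by blast
    qed
    have "incr \<beta> n (x i) (arc (x i) (x (Suc i mod 2 ^ n))) = incr \<beta> n (g i) (d i)" if i: "i < 2 ^ n" for i
    proof -
      have "x (Suc i mod 2 ^ n) = frac (g (Suc i))"
      proof (cases "Suc i < 2 ^ n")
        case False
        then have "Suc i = 2 ^ n" using i by simp
        then have "frac (g (Suc i)) = frac (g 0)" using gN by (simp add: frac_def)
        then show ?thesis using \<open>Suc i = 2 ^ n\<close> x[of 0] by simp
      next
        case True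
        then show ?thesis using x[OF True] by simp
      qed
      then have "arc (x i) (x (Suc i mod 2 ^ n)) = frac (d i)" using x[OF i] by (simp add: arc_frac d_def)
      also have "\<dots> = d i" using d0[of i] d1[OF i] by (simp add: frac_eq)
      finally show ?thesis using x[OF i] incr_frac by simp
    qed
    then show ?thesis unfolding if_not_P[OF False] by simp
  qed
  then show ?thesis
    unfolding grid_dens_def x_def[symmetric] g_def[symmetric] rhs by simp
qed

text \<open>The bound is uniform in the level and the lift: the \<open>q\<close> terms telescope to
  at most \<open>B\<close>, and the slope terms form an average of numbers bounded by
  \<open>L\<close>. The summand 1 in the witness secures \<open>b > 0\<close>.\<close>

lemma grid_dens_bounds:
  obtains b where "b > 0" "\<And>n G. is_lift G \<Longrightarrow>
    \<bar>ln (grid_dens \<beta> n (\<lambda>i\<in>{..<2 ^ n}. frac (G (grid n i))))\<bar> \<le> b"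
proof -
  obtain B where B: "B \<ge> 0" "\<And>x y. \<bar>ln (f x) - ln (f y)\<bar> \<le> B * \<bar>x - y\<bar>"
    using ln_f_lipschitz by metis
  obtain L where L: "L \<ge> 0" "\<And>x. \<bar>ln (f x)\<bar> \<le> L" using ln_f_bounded by metis
  show ?thesis
  proof (rule that[of "B + \<bar>\<beta>\<bar> * L + 1"])
    show "B + \<bar>\<beta>\<bar> * L + 1 > 0" using B(1) L(1) by (simp add: add_nonneg_pos)
    fix n G assume G: "is_lift G"
    define g where "g i = G (grid n i)" for i
    have m: "g i \<le> g (Suc i)" for i
      unfolding g_def using grid_le monoD[OF is_liftD(1)[OF G]] by blast
    have gN: "g (2 ^ n) = g 0 + 1" using is_liftD(2)[OF G, of 0] by (simp add: g_def)
    have "\<bar>\<Sum>i<2 ^ n. q (g i) (g (Suc i))\<bar> \<le> (\<Sum>i<2 ^ n. B * (g (Suc i) - g i))"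
      by (rule order_trans[OF sum_abs]) (intro sum_mono q_bounded[OF B(2)] m)
    also have "\<dots> = B" using sum_lessThan_telescope[of g "2 ^ n"] gN by (simp add: sum_distrib_left[symmetric])
    finally have 1: "\<bar>\<Sum>i<2 ^ n. q (g i) (g (Suc i))\<bar> \<le> B" .
    have "\<bar>\<Sum>i<2 ^ n. ln (slope (g i) (g (Suc i))) * (1 / 2 ^ n)\<bar> \<le> (\<Sum>i<(2::nat) ^ n. L * (1 / 2 ^ n))"
      by (rule order_trans[OF sum_abs])
        (intro sum_mono, use ln_slope_bounded[OF L(2) m] in \<open>simp add: abs_mult divide_right_mono\<close>)
    also have "\<dots> = L" by simp
    finally have 2: "\<bar>\<Sum>i<2 ^ n. ln (slope (g i) (g (Suc i))) * (1 / 2 ^ n)\<bar> \<le> L" .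
    have "\<bar>\<beta> * (\<Sum>i<2 ^ n. ln (slope (g i) (g (Suc i))) * (1 / 2 ^ n))\<bar> \<le> \<bar>\<beta>\<bar> * L"
      using 2 by (simp only: abs_mult mult_left_mono abs_ge_zero)
    with 1 have "\<bar>(\<Sum>i<2 ^ n. q (g i) (g (Suc i))) + \<beta> * (\<Sum>i<2 ^ n. ln (slope (g i) (g (Suc i))) * (1 / 2 ^ n))\<bar>
        \<le> B + \<bar>\<beta>\<bar> * L + 1" by linarith
    then show "\<bar>ln (grid_dens \<beta> n (\<lambda>i\<in>{..<2 ^ n}. frac (G (grid n i))))\<bar> \<le> B + \<bar>\<beta>\<bar> * L + 1"
      unfolding g_def grid_dens_lift[OF G] by simp
  qed
qed

text \<open>The pointwise identity behind the change of variables: \<open>h\<close> stretches each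
  arc by its slope, and the resulting powers of the slopes combine with the Jacobian to
  \<open>grid_dens\<close>.\<close>

lemma dir_density_h:
  assumes n: "n > 0" and x: "x \<in> PiE {..<2 ^ n} (\<lambda>_. {0..<1})"
  shows "indicator (dir_support (2 ^ n)) (\<lambda>i\<in>{..<2 ^ n}. h (x i))
      * ennreal (dir_density \<beta> (2 ^ n) (grid n) (\<lambda>i\<in>{..<2 ^ n}. h (x i))) * (\<Prod>i<2 ^ n. ennreal (f (x i)))
    = indicator (dir_support (2 ^ n)) x * ennreal (dir_density \<beta> (2 ^ n) (grid n) x) * ennreal (grid_dens \<beta> n x)"
proof -
  let ?N = "2 ^ n :: nat"
  define y where "y = (\<lambda>i\<in>{..<?N}. h (x i))"
  have y: "y i = frac (H (x i))" if "i < ?N" for i using that by (simp add: y_def h_def)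
  have xK: "x i = frac (K (y i))" if "i < ?N" for i
  proof -
    have "frac (K (y i)) = frac (x i)" using hinv_h[of "x i"] that by (simp add: hinv_def y_def)
    then show ?thesis using x that by (auto simp: PiE_iff frac_eq)
  qed
  have Suc_mod: "Suc i mod ?N < ?N" for i by simp
  have supp: "y \<in> dir_support ?N \<longleftrightarrow> x \<in> dir_support ?N"
  proof -
    have "y \<in> PiE {..<?N} (\<lambda>_. {0..<1})" by (auto simp: y_def h_def frac_lt_1)
    moreover have "(\<Sum>i<?N. arc (y i) (y (Suc i mod ?N))) = 1" if "(\<Sum>i<?N. arc (x i) (x (Suc i mod ?N))) = 1"
      using sum_arc_lift[OF H_per strict_mono_H that] y Suc_mod by simp
    moreover have "(\<Sum>i<?N. arc (x i) (x (Suc i mod ?N))) = 1" if "(\<Sum>i<?N. arc (y i) (y (Suc i mod ?N))) = 1"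
      using sum_arc_lift[OF K_per strict_mono_K that] xK Suc_mod by simp
    ultimately show ?thesis using x by (auto simp: dir_support_def)
  qed
  show ?thesis
  proof (cases "x \<in> dir_support ?N")
    case False
    then show ?thesis using supp unfolding y_def by simp
  next
    case True
    define D where "D i = arc (x i) (x (Suc i mod ?N))" for i
    have arcy: "arc (y i) (y (Suc i mod ?N)) = slope (x i) (x i + D i) * D i" if "i < ?N" for i
    proof -
      have "arc (y i) (y (Suc i mod ?N)) = H (x i + D i) - H (x i)"
        using arc_lift[OF H_per strict_mono_H, of "x i" "x (Suc i mod ?N)"] y that Suc_mod by (simp add: D_def)
      then show ?thesis by (simp add: slope_def)
    qed
    define c where "c = Gamma \<beta> / (\<Prod>i<?N. Gamma (\<beta> * arc (grid n i) (grid n (Suc i mod ?N))))"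
    define e where "e = \<beta> / 2 ^ n - 1"
    have exps: "\<beta> * arc (grid n i) (grid n (Suc i mod ?N)) - 1 = e" if "i < ?N" for i
      using arc_grid[OF n that] by (simp add: e_def)
    have dx: "dir_density \<beta> ?N (grid n) x = c * (\<Prod>i<?N. D i powr e)"
      unfolding dir_density_def c_def D_def using exps by simp
    have dy: "dir_density \<beta> ?N (grid n) y = c * (\<Prod>i<?N. (slope (x i) (x i + D i) * D i) powr e)"
      unfolding dir_density_def c_def using exps arcy by simp
    have "dir_density \<beta> ?N (grid n) y * (\<Prod>i<?N. f (x i)) = dir_density \<beta> ?N (grid n) x * grid_dens \<beta> n x"
    \<comment> \<open>Since \<open>0 powr e = 0\<close> for every \<open>e\<close>, a vanishing arc
      makes both densities 0, even for negative exponents.\<close>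
    proof (cases "\<exists>i<?N. D i = 0")
      case True
      then have "(\<Prod>i<?N. D i powr e) = 0" "(\<Prod>i<?N. (slope (x i) (x i + D i) * D i) powr e) = 0"
        by (auto intro!: prod_zero)
      then show ?thesis unfolding dx dy by (simp only: mult_zero_left mult_zero_right)
    next
      case False
      then have Dpos: "D i > 0" if "i < ?N" for i
        using False that arc_nonneg[of "x i" "x (Suc i mod ?N)"] by (auto simp: D_def less_le)
      have spos: "slope (x i) (x i + D i) > 0" for i
        by (intro slope_pos) (simp add: D_def)
      have "D 0 > 0" by (rule Dpos) simp
      \<comment> \<open>Positive arcs rule out the branch of \<open>grid_dens\<close> for constant
        families.\<close>
      have nconst: "\<not> (\<forall>i<?N. x i = x 0)"
      proof
        assume "\<forall>i<?N. x i = x 0"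
        then have e: "x (Suc 0 mod ?N) = x 0" using Suc_mod[of 0] by blast
        have "D 0 = arc (x 0) (x 0)" unfolding D_def e ..
        then have "D 0 = 0" by (simp only: arc_self)
        then show False using \<open>D 0 > 0\<close> by simp
      qed
      have fD: "f (x i + D i) = f (x (Suc i mod ?N))" for i
        unfolding D_def add_arc using periodic_add_int[of f] f_per by blast
      \<comment> \<open>This is the even split of the Jacobian. Together with the -1 in the exponent
        \<open>e\<close> it accounts for the \<open>q\<close> part of \<open>incr\<close>.\<close>
      have "(\<Sum>i<?N. (ln (f (x i)) + ln (f (x (Suc i mod ?N)))) / 2) = (\<Sum>i<?N. ln (f (x i)))"
        using sum_cyclic[of "\<lambda>i. ln (f (x i))" ?N] by (simp add: sum.distrib sum_divide_distrib[symmetric])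
      then have "(\<Sum>i<?N. incr \<beta> n (x i) (D i)) = (\<Sum>i<?N. e * ln (slope (x i) (x i + D i)) + ln (f (x i)))"
        unfolding incr_def q_def fD e_def
        by (simp add: sum.distrib sum_subtractf algebra_simps sum_distrib_left)
      then have "grid_dens \<beta> n x = (\<Prod>i<?N. exp (e * ln (slope (x i) (x i + D i)) + ln (f (x i))))"
        unfolding grid_dens_def if_not_P[OF nconst] by (simp add: D_def exp_sum)
      also have "\<dots> = (\<Prod>i<?N. slope (x i) (x i + D i) powr e * f (x i))"
        using spos f_pos by (intro prod.cong) (auto simp: exp_add powr_def less_imp_neq[symmetric])
      finally have gd: "grid_dens \<beta> n x = (\<Prod>i<?N. slope (x i) (x i + D i) powr e * f (x i))" .
      have "(\<Prod>i<?N. (slope (x i) (x i + D i) * D i) powr e)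
          = (\<Prod>i<?N. slope (x i) (x i + D i) powr e) * (\<Prod>i<?N. D i powr e)"
        unfolding prod.distrib[symmetric] using spos Dpos
        by (intro prod.cong) (auto simp: powr_mult less_imp_le)
      then show ?thesis unfolding dx dy gd prod.distrib by simp
    qed
    moreover have "(\<Prod>i<?N. f (x i)) \<ge> 0" using f_pos by (simp add: prod_nonneg less_imp_le)
    moreover have "grid_dens \<beta> n x \<ge> 0" by (simp add: grid_dens_def)
    moreover have "(\<Prod>i<?N. ennreal (f (x i))) = ennreal (\<Prod>i<?N. f (x i))"
      using f_pos by (intro prod_ennreal) (simp add: less_imp_le)
    ultimately show ?thesis
      unfolding y_def[symmetric] using True supp by (simp add: ennreal_mult''[symmetric])
  qed
qed

text \<open>After substituting \<open>h x\<close> for \<open>x\<close>, the preimage of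
  \<open>A\<close> under \<open>hinv\<close> becomes \<open>A\<close> itself, and
  \<open>dir_density_h\<close> identifies what remains of the density.\<close>

lemma distr_hinv_marginal:
  fixes \<beta> :: real
  assumes n: "n > 0" and A [measurable]: "A \<in> sets (PiM {..<2 ^ n} (\<lambda>_. lborel))"
  defines "L \<equiv> density (PiM {..<2 ^ n} (\<lambda>_. lborel))
      (\<lambda>x. indicator (dir_support (2 ^ n)) x * ennreal (dir_density \<beta> (2 ^ n) (grid n) x))"
  shows "emeasure L ((\<lambda>x. \<lambda>i\<in>{..<2 ^ n}. hinv (x i)) -` A \<inter> space L)
    = (\<integral>\<^sup>+x. ennreal (grid_dens \<beta> n x) * indicator A x \<partial>L)"
proof -
  let ?N = "2 ^ n :: nat"
  let ?P = "PiM {..<?N} (\<lambda>_. lborel :: real measure)"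
  let ?h = "\<lambda>x. \<lambda>i\<in>{..<?N}. h (x i)" and ?k = "\<lambda>x. \<lambda>i\<in>{..<?N}. hinv (x i)"
  define w where "w x = indicator (dir_support ?N) x * ennreal (dir_density \<beta> ?N (grid n) x)" for x
  have [measurable]: "w \<in> borel_measurable ?P" unfolding w_def by measurable
  have L: "L = density ?P w" unfolding L_def w_def ..
  have km [measurable]: "?k \<in> ?P \<rightarrow>\<^sub>M ?P" by measurable
  have [measurable]: "(\<lambda>x. grid_dens \<beta> n x) \<in> borel_measurable ?P"
    by (intro grid_dens_measurable) measurable
  have kA: "?k -` A \<inter> space ?P \<in> sets ?P" by (rule measurable_sets[OF km A])
  \<comment> \<open>The indicator of the unit cube can be inserted freely, which brings the integral
    into the form required by \<open>nn_integral_PiM_h\<close>.\<close>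
  have w_supp: "w x * (\<Prod>i<?N. indicator {0..<1} (x i)) = w x" if "x \<in> space ?P" for x
    by (cases "x \<in> dir_support ?N") (auto simp: w_def dir_support_def PiE_iff)
  have "emeasure L (?k -` A \<inter> space L) = (\<integral>\<^sup>+x. w x * indicator A (?k x) \<partial>?P)"
    unfolding L using kA by (subst emeasure_density) (auto intro!: nn_integral_cong simp: indicator_def)
  also have "\<dots> = (\<integral>\<^sup>+x. w x * indicator A (?k x) * (\<Prod>i<?N. indicator {0..<1} (x i)) \<partial>?P)"
  proof (intro nn_integral_cong)
    fix x assume "x \<in> space ?P"
    from w_supp[OF this] show "w x * indicator A (?k x)
        = w x * indicator A (?k x) * (\<Prod>i<?N. indicator {0..<1} (x i))"
      by (simp only: mult.commute[of "w x"] mult.assoc)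
  qed
  also have "\<dots> = (\<integral>\<^sup>+x. w (?h x) * indicator A (?k (?h x)) * (\<Prod>i<?N. indicator {0..<1} (x i) * ennreal (f (x i))) \<partial>?P)"
    by (rule nn_integral_PiM_h) measurable
  also have "\<dots> = (\<integral>\<^sup>+x. w x * (ennreal (grid_dens \<beta> n x) * indicator A x) \<partial>?P)"
  proof (intro nn_integral_cong)
    fix x assume x: "x \<in> space ?P"
    show "w (?h x) * indicator A (?k (?h x)) * (\<Prod>i<?N. indicator {0..<1} (x i) * ennreal (f (x i)))
        = w x * (ennreal (grid_dens \<beta> n x) * indicator A x)"
    proof (cases "x \<in> PiE {..<?N} (\<lambda>_. {0..<1})")
      case False
      then obtain i where "i < ?N" "x i \<notin> {0..<1}" using x by (auto simp: space_PiM PiE_iff)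
      then have "(\<Prod>i<?N. indicator {0..<1} (x i) * ennreal (f (x i))) = 0"
        by (intro prod_zero) (auto intro!: bexI[of _ i])
      moreover have "w x = 0" using False by (auto simp: w_def dir_support_def)
      ultimately show ?thesis by simp
    next
      case True
      have "?k (?h x) = x"
      proof
        fix i show "?k (?h x) i = x i"
          using True hinv_h[of "x i"] by (cases "i < ?N") (auto simp: PiE_iff frac_eq extensional_def)
      qed
      moreover have "(\<Prod>i<?N. indicator {0..<1} (x i) * ennreal (f (x i))) = (\<Prod>i<?N. ennreal (f (x i)))"
        using True by (intro prod.cong) (auto simp: PiE_iff)
      ultimately have "w (?h x) * indicator A (?k (?h x)) * (\<Prod>i<?N. indicator {0..<1} (x i) * ennreal (f (x i)))
          = w (?h x) * (\<Prod>i<?N. ennreal (f (x i))) * indicator A x"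
        by (simp only: ac_simps)
      also have "w (?h x) * (\<Prod>i<?N. ennreal (f (x i))) = w x * ennreal (grid_dens \<beta> n x)"
        using dir_density_h[OF n True, of \<beta>] unfolding w_def .
      finally show ?thesis by (simp only: mult.assoc)
    qed
  qed
  also have "\<dots> = (\<integral>\<^sup>+x. ennreal (grid_dens \<beta> n x) * indicator A x \<partial>L)"
    unfolding L by (subst nn_integral_density) auto
  finally show ?thesis .
qed

end

subsection \<open>The sigma-algebra on the space of circle maps\<close>

lemma space_G_space [simp]: "space G_space = Gset"
  by (auto simp: G_space_def space_measure_of_conv)

lemma sets_G_space: "sets G_space = sigma_sets Gset {{g \<in> Gset. g t \<in> B} | t B. B \<in> sets borel}"
  unfolding G_space_def by (rule sets_measure_of) auto

lemma eval_measurable: "(\<lambda>g. g t) \<in> borel_measurable G_space"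
proof (rule measurableI)
  fix B :: "real set" assume "B \<in> sets borel"
  then have "{g \<in> Gset. g t \<in> B} \<in> sets G_space" unfolding sets_G_space by blast
  then show "(\<lambda>g. g t) -` B \<inter> space G_space \<in> sets G_space"
    by (simp add: vimage_def Int_def conj_commute)
qed simp

lemma measurable_into_G_space:
  assumes "\<And>x. x \<in> space M \<Longrightarrow> T x \<in> Gset" "\<And>t. (\<lambda>x. T x t) \<in> borel_measurable M"
  shows "T \<in> M \<rightarrow>\<^sub>M G_space"
  unfolding G_space_def
proof (rule measurable_measure_of)
  fix Y assume "Y \<in> {{g \<in> Gset. g t \<in> B} | t B. B \<in> sets borel}"
  then obtain t B where B: "B \<in> sets borel" and Y: "Y = {g \<in> Gset. g t \<in> B}" by blast
  have "T -` Y \<inter> space M = (\<lambda>x. T x t) -` B \<inter> space M" using assms(1) Y by auto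
  then show "T -` Y \<inter> space M \<in> sets M" using measurable_sets[OF assms(2) B] by simp
qed (use assms(1) in auto)

lemma lift_of_is_lift:
  assumes "g \<in> Gset"
  shows "is_lift (lift_of g)" "g x = frac (lift_of g x)"
proof -
  have "\<exists>G. is_lift G \<and> g = (\<lambda>x. frac (G x))" using assms by (simp add: Gset_def)
  then have *: "is_lift (lift_of g) \<and> g = (\<lambda>x. frac (lift_of g x))"
    unfolding lift_of_def by (rule someI_ex)
  then show "is_lift (lift_of g)" by blast
  show "g x = frac (lift_of g x)" using conjunct2[OF *] by (rule fun_cong)
qed

lemma Gset_I: "is_lift G \<Longrightarrow> (\<lambda>x. frac (G x)) \<in> Gset"
  by (auto simp: Gset_def)

lemma Gset_range: "g \<in> Gset \<Longrightarrow> 0 \<le> g x" "g \<in> Gset \<Longrightarrow> g x < 1"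
  using lift_of_is_lift(2)[of g x] by (simp_all add: frac_lt_1)

lemma Gset_frac: "g \<in> Gset \<Longrightarrow> frac (g x) = g x"
  using Gset_range[of g x] by (simp add: frac_eq)

lemma Gset_periodic: "g \<in> Gset \<Longrightarrow> g (x + 1) = g x"
  using lift_of_is_lift[of g] is_liftD(2)[of "lift_of g" x] by (simp add: frac_def)

text \<open>\<open>frac\<close> is discontinuous only from the left at integers, and the lift
  approaches its limit from above, so the integer part is eventually constant.\<close>

lemma Gset_tendsto_from_right:
  assumes g: "g \<in> Gset" and s: "\<And>n. t \<le> s n" "s \<longlonglongrightarrow> t"
  shows "(\<lambda>n. g (s n)) \<longlonglongrightarrow> g t"
proof -
  define G where "G = lift_of g"
  have G: "is_lift G" and gG: "g x = frac (G x)" for x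
    unfolding G_def using lift_of_is_lift[OF g] by auto
  have lim: "(\<lambda>n. G (s n)) \<longlonglongrightarrow> G t" using lift_tendsto_from_right[OF G s] .
  have ge: "G t \<le> G (s n)" for n using monoD[OF is_liftD(1)[OF G] s(1)] .
  have "G t < of_int \<lfloor>G t\<rfloor> + 1" by linarith
  then have "\<forall>\<^sub>F n in sequentially. G (s n) < of_int \<lfloor>G t\<rfloor> + 1"
    by (rule order_tendstoD(2)[OF lim])
  then have "\<forall>\<^sub>F n in sequentially. G (s n) - of_int \<lfloor>G t\<rfloor> = g (s n)"
  proof eventually_elim
    case (elim n)
    have "\<lfloor>G (s n)\<rfloor> = \<lfloor>G t\<rfloor>" using elim ge[of n] by (intro floor_unique) linarith+
    then show ?case by (simp add: gG frac_def)
  qed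
  moreover have "(\<lambda>n. G (s n) - of_int \<lfloor>G t\<rfloor>) \<longlonglongrightarrow> G t - of_int \<lfloor>G t\<rfloor>"
    by (intro tendsto_intros lim)
  ultimately have "(\<lambda>n. g (s n)) \<longlonglongrightarrow> G t - of_int \<lfloor>G t\<rfloor>"
    by (rule Lim_transform_eventually[rotated])
  then show ?thesis by (simp add: gG frac_def)
qed

section \<open>Cylinder sets over dyadic grids\<close>

definition grid_eval :: "nat \<Rightarrow> (real \<Rightarrow> real) \<Rightarrow> nat \<Rightarrow> real" where
  "grid_eval n g = (\<lambda>i\<in>{..<2 ^ n}. g (grid n i))"

definition grid_cyl :: "nat \<Rightarrow> (nat \<Rightarrow> real) set \<Rightarrow> (real \<Rightarrow> real) set" where
  "grid_cyl n A = {g \<in> Gset. grid_eval n g \<in> A}"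

definition grid_cyls :: "(real \<Rightarrow> real) set set" where
  "grid_cyls = {grid_cyl n A | n A. n > 0 \<and> A \<in> sets (PiM {..<2 ^ n} (\<lambda>_. lborel))}"

lemma grid_eval_measurable [measurable]: "grid_eval n \<in> G_space \<rightarrow>\<^sub>M PiM {..<2 ^ n} (\<lambda>_. lborel)"
  unfolding grid_eval_def[abs_def] using eval_measurable by (intro measurable_restrict) simp

lemma grid_cyl_sets:
  assumes "A \<in> sets (PiM {..<2 ^ n} (\<lambda>_. lborel))"
  shows "grid_cyl n A \<in> sets G_space"
proof -
  have "grid_cyl n A = grid_eval n -` A \<inter> space G_space" by (auto simp: grid_cyl_def)
  then show ?thesis using measurable_sets[OF grid_eval_measurable assms] by simp
qed

text \<open>The grids are nested: the point with index \<open>i\<close> at level \<open>n\<close>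
  has index \<open>i * 2 ^ k\<close> at level \<open>n + k\<close>, and \<open>r\<close> selects
  these coordinates.\<close>

lemma grid_cyl_refine:
  assumes "n \<le> m" "A \<in> sets (PiM {..<2 ^ n} (\<lambda>_. lborel))"
  obtains B where "B \<in> sets (PiM {..<2 ^ m} (\<lambda>_. lborel))" "grid_cyl n A = grid_cyl m B"
proof -
  obtain k where m: "m = n + k" using assms(1) le_Suc_ex by blast
  have less: "i * 2 ^ k < (2 :: nat) ^ m" if "i < 2 ^ n" for i
    using that by (simp add: m power_add)
  define r :: "(nat \<Rightarrow> real) \<Rightarrow> nat \<Rightarrow> real" where "r x = (\<lambda>i\<in>{..<2 ^ n}. x (i * 2 ^ k))" for x
  have r: "r \<in> PiM {..<2 ^ m} (\<lambda>_. lborel) \<rightarrow>\<^sub>M PiM {..<2 ^ n} (\<lambda>_. lborel)"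
    unfolding r_def using less by (intro measurable_restrict measurable_component_singleton) auto
  have "r (grid_eval m g) = grid_eval n g" for g
  proof
    fix i show "r (grid_eval m g) i = grid_eval n g i"
      using less[of i] by (cases "i < 2 ^ n") (auto simp: r_def grid_eval_def grid_def m power_add)
  qed
  moreover have "grid_eval m g \<in> space (PiM {..<2 ^ m} (\<lambda>_. lborel))" for g
    by (simp add: grid_eval_def space_PiM)
  ultimately have "grid_cyl n A = grid_cyl m (r -` A \<inter> space (PiM {..<2 ^ m} (\<lambda>_. lborel)))"
    by (simp add: grid_cyl_def)
  then show ?thesis using that measurable_sets[OF r assms(2)] by blast
qed

lemma Int_stable_grid_cyls: "Int_stable grid_cyls"
proof (rule Int_stableI)
  fix X Y assume "X \<in> grid_cyls" "Y \<in> grid_cyls"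
  then obtain n A m B where n: "n > 0" "A \<in> sets (PiM {..<2 ^ n} (\<lambda>_. lborel))" "X = grid_cyl n A"
    and m: "m > 0" "B \<in> sets (PiM {..<2 ^ m} (\<lambda>_. lborel))" "Y = grid_cyl m B"
    unfolding grid_cyls_def by blast
  obtain A' where A': "A' \<in> sets (PiM {..<2 ^ max n m} (\<lambda>_. lborel))" "X = grid_cyl (max n m) A'"
    using grid_cyl_refine[of n "max n m" A] n by auto
  obtain B' where B': "B' \<in> sets (PiM {..<2 ^ max n m} (\<lambda>_. lborel))" "Y = grid_cyl (max n m) B'"
    using grid_cyl_refine[of m "max n m" B] m by auto
  have eq: "X \<inter> Y = grid_cyl (max n m) (A' \<inter> B')" using A' B' by (auto simp: grid_cyl_def)
  show "X \<inter> Y \<in> grid_cyls"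
    unfolding grid_cyls_def eq mem_Collect_eq
    by (rule exI[of _ "max n m"], rule exI[of _ "A' \<inter> B'"]) (use A'(1) B'(1) n(1) in auto)
qed

lemma grid_cyls_subset: "grid_cyls \<subseteq> Pow Gset"
  by (auto simp: grid_cyls_def grid_cyl_def)

text \<open>By right continuity, the values on the dyadic points determine all others.\<close>
lemma sets_G_space_grid_cyls: "sets G_space = sigma_sets Gset grid_cyls"
proof
  show "sigma_sets Gset grid_cyls \<subseteq> sets G_space"
    using sets.sigma_sets_subset[of grid_cyls G_space] grid_cyl_sets by (auto simp: grid_cyls_def)
  define S where "S = sigma Gset grid_cyls"
  have spS: "space S = Gset" and seS: "sets S = sigma_sets Gset grid_cyls"
    unfolding S_def using grid_cyls_subset by (auto simp: space_measure_of_conv)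
  have dyadic: "(\<lambda>g. g (grid n i)) \<in> borel_measurable S" if n: "n > 0" and i: "i < 2 ^ n" for n i
  proof (rule measurableI)
    fix B :: "real set" assume B: "B \<in> sets borel"
    define A where "A = (\<lambda>x. x i) -` B \<inter> space (PiM {..<2 ^ n} (\<lambda>_. lborel :: real measure))"
    have "A \<in> sets (PiM {..<2 ^ n} (\<lambda>_. lborel))" unfolding A_def
      by (rule measurable_sets[OF measurable_component_singleton]) (use i B in auto)
    then have "grid_cyl n A \<in> sets S" unfolding seS grid_cyls_def using n by blast
    moreover have "(\<lambda>g. g (grid n i)) -` B \<inter> space S = grid_cyl n A"
      unfolding spS grid_cyl_def A_def using i by (auto simp: grid_eval_def space_PiM)
    ultimately show "(\<lambda>g. g (grid n i)) -` B \<inter> space S \<in> sets S" by simp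
  qed simp
  have eval: "(\<lambda>g. g t) \<in> borel_measurable S" for t
  proof -
    \<comment> \<open>\<open>s n\<close> is a dyadic point to the right of \<open>t\<close> at
      distance at most \<open>1 / 2 ^ n\<close>; reducing its numerator modulo \<open>2 ^ n\<close>
      gives the index \<open>j n\<close> of the same circle point.\<close>
    define a where "a n = \<lfloor>t * 2 ^ n\<rfloor> + 1" for n :: nat
    define s where "s n = of_int (a n) / (2 ^ n :: real)" for n
    define j where "j n = nat (a n mod 2 ^ n)" for n
    have j: "j n < 2 ^ n" for n
      by (simp add: j_def nat_less_iff)
    have gs: "g (s n) = g (grid n (j n))" if "g \<in> Gset" for g n
    proof -
      have "int (j n) + 2 ^ n * (a n div 2 ^ n) = a n" by (simp add: j_def)
      from arg_cong[OF this, of real_of_int] have "of_int (a n) = real (j n) + 2 ^ n * of_int (a n div 2 ^ n)"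
        by simp
      then have "s n = grid n (j n) + of_int (a n div 2 ^ n)"
        by (simp add: s_def grid_def add_divide_distrib)
      then show ?thesis using periodic_add_int[of g] Gset_periodic[OF that] by metis
    qed
    have ts: "t \<le> s n" "s n \<le> t + 1 / 2 ^ n" for n
    proof -
      have "t * 2 ^ n \<le> of_int (a n)" "of_int (a n) \<le> t * 2 ^ n + 1" unfolding a_def by linarith+
      then show "t \<le> s n" "s n \<le> t + 1 / 2 ^ n"
        unfolding s_def by (simp_all add: pos_le_divide_eq pos_divide_le_eq distrib_right)
    qed
    have u: "(\<lambda>n. t + 1 / 2 ^ n) \<longlonglongrightarrow> t"
      using tendsto_add[OF tendsto_const inverse_pow2_tendsto_0] by simp
    have st: "s \<longlonglongrightarrow> t"
      by (rule tendsto_sandwich[OF _ _ tendsto_const u]) (use ts in auto)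
    show ?thesis
    proof (rule borel_measurable_LIMSEQ_real)
      \<comment> \<open>The shift to \<open>Suc n\<close> avoids level 0, for which there are no
        generating cylinders.\<close>
      show "(\<lambda>g. g (grid (Suc n) (j (Suc n)))) \<in> borel_measurable S" for n
        by (rule dyadic[OF _ j]) simp
      show "(\<lambda>n. g (grid (Suc n) (j (Suc n)))) \<longlonglongrightarrow> g t" if "g \<in> space S" for g
      proof -
        have g: "g \<in> Gset" using that by (simp add: spS)
        show ?thesis
          using LIMSEQ_Suc[OF Gset_tendsto_from_right[OF g ts(1) st]] unfolding gs[OF g] .
      qed
    qed
  qed
  have "{{g \<in> Gset. g t \<in> B} | t B. B \<in> sets borel} \<subseteq> sets S"
  proof clarify
    fix t and B :: "real set" assume "B \<in> sets borel"
    from measurable_sets[OF eval this, of t] show "{g \<in> Gset. g t \<in> B} \<in> sets S"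
      by (simp add: spS vimage_def Int_def conj_commute)
  qed
  then show "sets G_space \<subseteq> sigma_sets Gset grid_cyls"
    unfolding sets_G_space seS[symmetric] using sets.sigma_sets_subset[of _ S] by (simp add: spS)
qed

subsection \<open>Quasi-invariance\<close>

context circle_diffeo
begin

lemma comp_Gset:
  assumes "g \<in> Gset"
  shows "h \<circ> g \<in> Gset" "hinv \<circ> g \<in> Gset"
proof -
  define G where "G = lift_of g"
  have G: "is_lift G" and gG: "g x = frac (G x)" for x
    unfolding G_def using lift_of_is_lift[OF assms] by auto
  note mG = monoD[OF is_liftD(1)[OF G]]
  have "is_lift (\<lambda>x. H (G x))"
    unfolding is_lift_def
  proof (intro conjI allI)
    show "mono (\<lambda>x. H (G x))" by (intro monoI H_mono_le mG)
    show "continuous (at_right x) (\<lambda>x. H (G x))" for x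
      using continuous_within_compose3[OF cont_H is_liftD(3)[OF G]] .
  qed (simp add: is_liftD(2)[OF G] H_per)
  moreover have "h \<circ> g = (\<lambda>x. frac (H (G x)))"
    unfolding comp_def h_def gG using frac_lift_frac[of H, OF H_per] by simp
  ultimately show "h \<circ> g \<in> Gset" using Gset_I by simp
  have "is_lift (\<lambda>x. K (G x))"
    unfolding is_lift_def
  proof (intro conjI allI)
    show "mono (\<lambda>x. K (G x))"
      by (intro monoI monoD[OF strict_mono_mono[OF strict_mono_K]] mG)
    show "continuous (at_right x) (\<lambda>x. K (G x))" for x
      using continuous_within_compose3[OF cont_K is_liftD(3)[OF G]] .
  qed (simp add: is_liftD(2)[OF G] K_per)
  moreover have "hinv \<circ> g = (\<lambda>x. frac (K (G x)))"
    unfolding comp_def hinv_def gG using frac_lift_frac[of K, OF K_per] by simp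
  ultimately show "hinv \<circ> g \<in> Gset" using Gset_I by simp
qed

lemma comp_inverse:
  assumes "g \<in> Gset"
  shows "hinv \<circ> (h \<circ> g) = g" "h \<circ> (hinv \<circ> g) = g"
  using hinv_h h_hinv Gset_frac[OF assms] by (auto simp: fun_eq_iff)

lemma bij_comp_h: "bij_betw (\<lambda>g. h \<circ> g) Gset Gset"
  by (rule bij_betw_byWitness[where f' = "\<lambda>g. hinv \<circ> g"]) (use comp_inverse comp_Gset in auto)

lemma the_inv_comp_h:
  assumes "g \<in> Gset"
  shows "the_inv_into Gset (\<lambda>g. h \<circ> g) g = hinv \<circ> g"
  using bij_betw_imp_inj_on[OF bij_comp_h] comp_inverse(2)[OF assms] comp_Gset(2)[OF assms]
  by (rule the_inv_into_f_eq)

lemma comp_hinv_measurable: "(\<lambda>g. hinv \<circ> g) \<in> G_space \<rightarrow>\<^sub>M G_space"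
proof (rule measurable_into_G_space)
  show "(\<lambda>g. (hinv \<circ> g) t) \<in> borel_measurable G_space" for t
    using measurable_compose[OF eval_measurable hinv_measurable] by simp
qed (use comp_Gset(2) in simp)

lemma ln_jump_factor:
  assumes "x < y"
  shows "ln (sqrt (f x * f y) / ((H y - H x) / (y - x))) = q x y"
proof -
  have "slope x y > 0" using slope_pos assms by simp
  moreover have "slope x y = (H y - H x) / (y - x)" using assms by (simp add: slope_def)
  moreover have "f x * f y > 0" using f_pos by simp
  ultimately show ?thesis
    using f_pos[of x] f_pos[of y] assms H_mono[OF assms] by (simp add: q_def ln_div ln_sqrt ln_mult)
qed

text \<open>The time sums supply \<open>Xb\<close> and the range sums supply \<open>Y0\<close>. The
  hypothesis on \<open>lift_of h0\<close> ties the lift used in \<open>Yb\<close> to the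
  \<open>H\<close> of the locale.\<close>

lemma grid_dens_tendsto_Yb:
  assumes H: "lift_of h0 = H" and g: "g \<in> Gset"
  shows "(\<lambda>n. grid_dens \<beta> n (grid_eval n g)) \<longlonglongrightarrow> Yb \<beta> h0 g"
proof -
  define G where "G = lift_of g"
  have G: "is_lift G" and gG: "g x = frac (G x)" for x
    unfolding G_def using lift_of_is_lift[OF g] by auto
  have dH: "deriv H = f" using deriv_H DERIV_imp_deriv by blast
  have [measurable]: "G \<in> borel_measurable borel"
    using borel_measurable_mono is_liftD(1)[OF G] by blast
  obtain L where L: "\<And>x. \<bar>ln (f x)\<bar> \<le> L" using ln_f_bounded by metis
  have AE1: "AE s in lborel. s \<noteq> (1::real)" by (rule AE_lborel_singleton)
  have "integrable lborel (\<lambda>s. indicator {0..1} s *\<^sub>R ln (f (G s)))"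
  proof (rule Bochner_Integration.integrable_bound)
    show "integrable lborel (\<lambda>s. indicator {0..1::real} s * L)" by simp
    show "AE s in lborel. norm (indicator {0..1} s *\<^sub>R ln (f (G s))) \<le> norm (indicator {0..1} s * L)"
      using L by (intro AE_I2) (auto simp: indicator_def intro: order_trans[OF _ abs_ge_self])
  qed measurable
  \<comment> \<open>\<open>Xb\<close> is defined with the gauge integral; boundedness of
    \<open>ln f\<close> permits the passage to the Lebesgue integral.\<close>
  then have "integral {0..1} (\<lambda>s. ln (f (G s))) = (\<integral>s. indicator {0..1} s *\<^sub>R ln (f (G s)) \<partial>lborel)"
    by (subst set_borel_integral_eq_integral(2)[symmetric])
      (auto simp: set_integrable_def set_lebesgue_integral_def)
  also have "\<dots> = (\<integral>s. indicator {0..<1} s * ln (f (G s)) \<partial>lborel)"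
    using AE1 by (intro integral_cong_AE) (auto simp: indicator_def elim!: eventually_mono)
  finally have X: "Xb \<beta> h0 g = exp (\<beta> * (\<integral>s. indicator {0..<1} s * ln (f (G s)) \<partial>lborel))"
    unfolding Xb_def H dH gG by (simp add: f_frac)
  have "(\<Sum>\<^sub>\<infinity>a\<in>jumps G. ln (sqrt (f (Lim (at_left a) G) * f (G a))
        / ((H (G a) - H (Lim (at_left a) G)) / (G a - Lim (at_left a) G))))
      = (\<Sum>\<^sub>\<infinity>a\<in>jumps G. q (Lim (at_left a) G) (G a))"
    by (intro infsum_cong ln_jump_factor) (simp add: jumps_def)
  then have Y: "Y0 h0 g = exp (\<Sum>\<^sub>\<infinity>a\<in>jumps G. q (Lim (at_left a) G) (G a))"
    unfolding Y0_def Let_def H dH G_def[symmetric] by simp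
  have "grid_eval n g = (\<lambda>i\<in>{..<2 ^ n}. frac (G (grid n i)))" for n
    unfolding grid_eval_def gG ..
  then have "grid_dens \<beta> n (grid_eval n g) = exp ((\<Sum>i<2 ^ n. q (G (grid n i)) (G (grid n (Suc i))))
      + \<beta> * (\<Sum>i<2 ^ n. ln (slope (G (grid n i)) (G (grid n (Suc i)))) * (1 / 2 ^ n)))" for n
    using grid_dens_lift[OF G] by simp
  moreover have "(\<lambda>n. exp ((\<Sum>i<2 ^ n. q (G (grid n i)) (G (grid n (Suc i))))
      + \<beta> * (\<Sum>i<2 ^ n. ln (slope (G (grid n i)) (G (grid n (Suc i)))) * (1 / 2 ^ n))))
    \<longlonglongrightarrow> exp ((\<Sum>\<^sub>\<infinity>a\<in>jumps G. q (Lim (at_left a) G) (G a))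
      + \<beta> * (\<integral>s. indicator {0..<1} s * ln (f (G s)) \<partial>lborel))"
    by (intro tendsto_intros q_sums_tendsto slope_sums_tendsto G)
  ultimately show ?thesis unfolding Yb_def X Y by (simp add: exp_add mult.commute)
qed

lemma grid_dens_eval_bounds:
  obtains b where "\<And>n g. g \<in> Gset \<Longrightarrow> exp (- b) \<le> grid_dens \<beta> n (grid_eval n g)"
    "\<And>n g. g \<in> Gset \<Longrightarrow> grid_dens \<beta> n (grid_eval n g) \<le> exp b"
proof -
  obtain b where b: "\<And>n G. is_lift G \<Longrightarrow>
      \<bar>ln (grid_dens \<beta> n (\<lambda>i\<in>{..<2 ^ n}. frac (G (grid n i))))\<bar> \<le> b"
    using grid_dens_bounds by metis
  have "exp (- b) \<le> grid_dens \<beta> n (grid_eval n g) \<and> grid_dens \<beta> n (grid_eval n g) \<le> exp b"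
    if g: "g \<in> Gset" for n g
  proof -
    have "grid_eval n g = (\<lambda>i\<in>{..<2 ^ n}. frac (lift_of g (grid n i)))"
      unfolding grid_eval_def lift_of_is_lift(2)[OF g, symmetric] ..
    then have "\<bar>ln (grid_dens \<beta> n (grid_eval n g))\<bar> \<le> b"
      using b[OF lift_of_is_lift(1)[OF g]] by simp
    moreover have "grid_dens \<beta> n (grid_eval n g) > 0" by (simp add: grid_dens_def)
    ultimately show ?thesis
      using exp_le_cancel_iff[of "- b" "ln (grid_dens \<beta> n (grid_eval n g))"]
        exp_le_cancel_iff[of "ln (grid_dens \<beta> n (grid_eval n g))" b] by (simp add: abs_le_iff)
  qed
  then show ?thesis using that by blast
qed

text \<open>The definition, through a chosen lift and a sum over its jumps, gives no direct access
  to measurability. As a pointwise limit, \<open>Yb\<close> inherits it from functions of finitely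
  many values of \<open>g\<close>.\<close>

lemma Yb_measurable:
  assumes "lift_of h0 = H"
  shows "Yb \<beta> h0 \<in> borel_measurable G_space"
proof (rule borel_measurable_LIMSEQ_real)
  show "(\<lambda>g. grid_dens \<beta> n (grid_eval n g)) \<in> borel_measurable G_space" for n
  proof (rule grid_dens_measurable)
    show "(\<lambda>g. grid_eval n g i) \<in> borel_measurable G_space" if "i < 2 ^ n" for i
      using that eval_measurable by (simp add: grid_eval_def)
  qed
qed (use grid_dens_tendsto_Yb[OF assms] in simp)

lemma Yb_bounds:
  assumes "lift_of h0 = H"
  shows "\<exists>c C. 0 < c \<and> (\<forall>g\<in>Gset. c \<le> Yb \<beta> h0 g \<and> Yb \<beta> h0 g \<le> C)"
proof -
  obtain b where b: "\<And>n g. g \<in> Gset \<Longrightarrow> exp (- b) \<le> grid_dens \<beta> n (grid_eval n g)"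
    "\<And>n g. g \<in> Gset \<Longrightarrow> grid_dens \<beta> n (grid_eval n g) \<le> exp b"
    using grid_dens_eval_bounds by metis
  have "exp (- b) \<le> Yb \<beta> h0 g \<and> Yb \<beta> h0 g \<le> exp b" if g: "g \<in> Gset" for g
    using LIMSEQ_le_const[OF grid_dens_tendsto_Yb[OF assms g]]
      LIMSEQ_le_const2[OF grid_dens_tendsto_Yb[OF assms g]] b[OF g] by blast
  then show ?thesis by (intro exI[of _ "exp (- b)"] exI[of _ "exp b"]) simp
qed

text \<open>Composition with \<open>hinv\<close> acts coordinatewise on the grid values, so on
  cylinders of level \<open>n\<close> the claim reduces to the marginal.\<close>

lemma emeasure_comp_hinv_grid_cyl:
  assumes Q: "is_Qbeta \<beta> Q" and n: "n > 0" and A: "A \<in> sets (PiM {..<2 ^ n} (\<lambda>_. lborel))"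
  shows "emeasure (distr Q G_space (\<lambda>g. hinv \<circ> g)) (grid_cyl n A)
    = (\<integral>\<^sup>+g. ennreal (grid_dens \<beta> n (grid_eval n g)) * indicator (grid_cyl n A) g \<partial>Q)"
proof -
  let ?P = "PiM {..<2 ^ n} (\<lambda>_. lborel :: real measure)"
  have sQ: "sets Q = sets G_space" and spQ: "space Q = Gset" using Q by (auto simp: is_Qbeta_def)
  have evm: "grid_eval n \<in> Q \<rightarrow>\<^sub>M ?P"
    using measurable_cong_sets[OF sQ refl] grid_eval_measurable by blast
  have hm: "(\<lambda>g. hinv \<circ> g) \<in> Q \<rightarrow>\<^sub>M G_space"
    using measurable_cong_sets[OF sQ refl] comp_hinv_measurable by blast
  have gdm: "grid_dens \<beta> n \<in> borel_measurable ?P"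
    by (rule grid_dens_measurable) measurable
  define L where "L = density ?P (\<lambda>x. indicator (dir_support (2 ^ n)) x * ennreal (dir_density \<beta> (2 ^ n) (grid n) x))"
  have "inj_on (grid n) {..<2 ^ n}" by (auto simp: inj_on_def grid_def)
  moreover have "\<forall>i<2 ^ n. grid n i \<in> {0..<1}" by (simp add: grid_def)
  ultimately have L: "distr Q ?P (grid_eval n) = L"
    using Q sum_arc_grid[OF n] unfolding is_Qbeta_def L_def grid_eval_def[abs_def] by blast
  let ?k = "\<lambda>x. \<lambda>i\<in>{..<2 ^ n}. hinv (x i)"
  have km: "?k \<in> ?P \<rightarrow>\<^sub>M ?P" by measurable
  have spL: "space L = space ?P" by (simp add: L_def)
  have kA: "?k -` A \<inter> space L \<in> sets ?P" unfolding spL by (rule measurable_sets[OF km A])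
  have "?k (grid_eval n g) = grid_eval n (hinv \<circ> g)" for g by (auto simp: grid_eval_def fun_eq_iff)
  moreover have "grid_eval n g \<in> space ?P" for g by (simp add: grid_eval_def space_PiM)
  ultimately have eq: "(\<lambda>g. hinv \<circ> g) -` grid_cyl n A \<inter> space Q = grid_eval n -` (?k -` A \<inter> space L) \<inter> space Q"
    using comp_Gset(2) by (auto simp: grid_cyl_def spQ spL)
  have "emeasure (distr Q G_space (\<lambda>g. hinv \<circ> g)) (grid_cyl n A)
      = emeasure Q (grid_eval n -` (?k -` A \<inter> space L) \<inter> space Q)"
    by (subst emeasure_distr[OF hm grid_cyl_sets[OF A]]) (simp only: eq)
  also have "\<dots> = emeasure L (?k -` A \<inter> space L)"
    unfolding L[symmetric] using emeasure_distr[OF evm] kA unfolding L by simp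
  also have "\<dots> = (\<integral>\<^sup>+x. ennreal (grid_dens \<beta> n x) * indicator A x \<partial>L)"
    unfolding L_def by (rule distr_hinv_marginal[OF n A])
  also have "\<dots> = (\<integral>\<^sup>+g. ennreal (grid_dens \<beta> n (grid_eval n g)) * indicator A (grid_eval n g) \<partial>Q)"
    unfolding L[symmetric] using gdm A by (intro nn_integral_distr evm) auto
  also have "\<dots> = (\<integral>\<^sup>+g. ennreal (grid_dens \<beta> n (grid_eval n g)) * indicator (grid_cyl n A) g \<partial>Q)"
    by (intro nn_integral_cong) (simp add: spQ grid_cyl_def indicator_def)
  finally show ?thesis .
qed

lemma distr_comp_hinv:
  assumes Q: "is_Qbeta \<beta> Q" and H: "lift_of h0 = H"
  shows "distr Q G_space (\<lambda>g. hinv \<circ> g) = density Q (\<lambda>g. ennreal (Yb \<beta> h0 g))"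
proof (rule measure_eqI_generator_eq[OF Int_stable_grid_cyls grid_cyls_subset])
  have sQ: "sets Q = sets G_space" and spQ: "space Q = Gset" and "prob_space Q"
    using Q by (auto simp: is_Qbeta_def)
  interpret prob_space Q by fact
  have hm: "(\<lambda>g. hinv \<circ> g) \<in> Q \<rightarrow>\<^sub>M G_space"
    using measurable_cong_sets[OF sQ refl] comp_hinv_measurable by blast
  have Ym [measurable]: "Yb \<beta> h0 \<in> borel_measurable Q"
    using measurable_cong_sets[OF sQ refl] Yb_measurable[OF H] by blast
  have gdm [measurable]: "(\<lambda>g. grid_dens \<beta> n (grid_eval n g)) \<in> borel_measurable Q" for n
  proof (rule grid_dens_measurable)
    show "(\<lambda>g. grid_eval n g i) \<in> borel_measurable Q" if "i < 2 ^ n" for i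
      using that eval_measurable measurable_cong_sets[OF sQ refl] by (auto simp: grid_eval_def)
  qed
  obtain b where b: "\<And>n g. g \<in> Gset \<Longrightarrow> grid_dens \<beta> n (grid_eval n g) \<le> exp b"
    using grid_dens_eval_bounds by metis
  show "emeasure (distr Q G_space (\<lambda>g. hinv \<circ> g)) C = emeasure (density Q (\<lambda>g. ennreal (Yb \<beta> h0 g))) C"
    if "C \<in> grid_cyls" for C
  proof -
    obtain n A where n: "n > 0" and A: "A \<in> sets (PiM {..<2 ^ n} (\<lambda>_. lborel))" and C: "C = grid_cyl n A"
      using \<open>C \<in> grid_cyls\<close> unfolding grid_cyls_def by blast
    have Cs [measurable]: "C \<in> sets Q" unfolding C sQ by (rule grid_cyl_sets[OF A])
    \<comment> \<open>A cylinder of level \<open>n\<close> is also one of every finer level, so this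
      sequence of integrals is constant in \<open>m\<close> and its limit can be read off.\<close>
    have eq: "(\<integral>\<^sup>+g. ennreal (grid_dens \<beta> (m + n) (grid_eval (m + n) g)) * indicator C g \<partial>Q)
        = emeasure (distr Q G_space (\<lambda>g. hinv \<circ> g)) C" for m
    proof -
      obtain B where "B \<in> sets (PiM {..<2 ^ (m + n)} (\<lambda>_. lborel))" "C = grid_cyl (m + n) B"
        using grid_cyl_refine[of n "m + n" A] A C by auto
      then show ?thesis using emeasure_comp_hinv_grid_cyl[OF Q, of "m + n" B] n by simp
    qed
    have "(\<lambda>m. \<integral>\<^sup>+g. ennreal (grid_dens \<beta> (m + n) (grid_eval (m + n) g)) * indicator C g \<partial>Q)
        \<longlonglongrightarrow> (\<integral>\<^sup>+g. ennreal (Yb \<beta> h0 g) * indicator C g \<partial>Q)"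
    proof (rule nn_integral_dominated_convergence[where w = "\<lambda>_. ennreal (exp b)"])
      show "(\<integral>\<^sup>+_. ennreal (exp b) \<partial>Q) < \<infinity>" by (simp add: emeasure_space_1)
      show "AE g in Q. ennreal (grid_dens \<beta> (m + n) (grid_eval (m + n) g)) * indicator C g \<le> ennreal (exp b)" for m
        using b by (intro AE_I2) (auto simp: spQ indicator_def intro: ennreal_leI)
      show "AE g in Q. (\<lambda>m. ennreal (grid_dens \<beta> (m + n) (grid_eval (m + n) g)) * indicator C g)
          \<longlonglongrightarrow> ennreal (Yb \<beta> h0 g) * indicator C g"
      proof (rule AE_I2)
        fix g assume "g \<in> space Q"
        then have "(\<lambda>m. grid_dens \<beta> (m + n) (grid_eval (m + n) g)) \<longlonglongrightarrow> Yb \<beta> h0 g"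
          using LIMSEQ_ignore_initial_segment[OF grid_dens_tendsto_Yb[OF H]] spQ by blast
        then have "(\<lambda>m. ennreal (grid_dens \<beta> (m + n) (grid_eval (m + n) g))) \<longlonglongrightarrow> ennreal (Yb \<beta> h0 g)"
          by (rule tendsto_ennrealI)
        then show "(\<lambda>m. ennreal (grid_dens \<beta> (m + n) (grid_eval (m + n) g)) * indicator C g)
            \<longlonglongrightarrow> ennreal (Yb \<beta> h0 g) * indicator C g"
          by (cases "g \<in> C") auto
      qed
    qed measurable
    then have "emeasure (distr Q G_space (\<lambda>g. hinv \<circ> g)) C = (\<integral>\<^sup>+g. ennreal (Yb \<beta> h0 g) * indicator C g \<partial>Q)"
      unfolding eq by (simp add: LIMSEQ_const_iff)
    then show ?thesis by (simp add: emeasure_density)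
  qed
  show "sets (distr Q G_space (\<lambda>g. hinv \<circ> g)) = sigma_sets Gset grid_cyls"
    by (simp add: sets_G_space_grid_cyls)
  show "sets (density Q (\<lambda>g. ennreal (Yb \<beta> h0 g))) = sigma_sets Gset grid_cyls"
    by (simp add: sQ sets_G_space_grid_cyls)
  let ?A = "space (PiM {..<2 ^ 1} (\<lambda>_. lborel :: real measure))"
  have "grid_cyl 1 ?A = Gset"
    by (auto simp: grid_cyl_def grid_eval_def space_PiM)
  moreover have "grid_cyl 1 ?A \<in> grid_cyls"
    unfolding grid_cyls_def using zero_less_one sets.top by blast
  ultimately have "Gset \<in> grid_cyls" by metis
  then show "range (\<lambda>_::nat. Gset) \<subseteq> grid_cyls" by blast
  show "emeasure (distr Q G_space (\<lambda>g. hinv \<circ> g)) Gset \<noteq> \<infinity>"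
    using prob_space.emeasure_space_1[OF prob_space_distr[OF hm]] by simp
qed auto

end

theorem theorem4p1:
  fixes \<beta> :: real and h :: "real \<Rightarrow> real" and Q :: "(real \<Rightarrow> real) measure"
  assumes "\<beta> > 0"
    and "h \<in> Gset"
    and "\<forall>x. lift_of h differentiable at x"
    and "\<forall>x. deriv (lift_of h) x > 0"
    and "\<forall>x. deriv (lift_of h) differentiable at x"
    and "continuous_on UNIV (deriv (deriv (lift_of h)))"
    and "is_Qbeta \<beta> Q"
  shows "bij_betw (\<lambda>g. h \<circ> g) Gset Gset
    \<and> the_inv_into Gset (\<lambda>g. h \<circ> g) \<in> G_space \<rightarrow>\<^sub>M G_space
    \<and> Yb \<beta> h \<in> borel_measurable G_space
    \<and> distr Q G_space (the_inv_into Gset (\<lambda>g. h \<circ> g)) = density Q (\<lambda>g. ennreal (Yb \<beta> h g))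
    \<and> (\<exists>c C. 0 < c \<and> (\<forall>g\<in>Gset. c \<le> Yb \<beta> h g \<and> Yb \<beta> h g \<le> C))"
proof -
  interpret D: circle_diffeo "lift_of h" "deriv (lift_of h)" "deriv (deriv (lift_of h))"
  proof
    show "(lift_of h has_real_derivative deriv (lift_of h) x) (at x)" for x
      using assms(3) by (simp add: DERIV_deriv_iff_real_differentiable)
    show "(deriv (lift_of h) has_real_derivative deriv (deriv (lift_of h)) x) (at x)" for x
      using assms(5) by (simp add: DERIV_deriv_iff_real_differentiable)
    show "lift_of h (x + 1) = lift_of h x + 1" for x
      using is_liftD(2)[OF lift_of_is_lift(1)[OF assms(2)]] .
  qed (use assms(4,6) in auto)
  have h: "D.h = h"
    using lift_of_is_lift(2)[OF assms(2)] by (simp add: D.h_def fun_eq_iff)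
  have spQ: "space Q = Gset" using assms(7) by (simp add: is_Qbeta_def)
  note inv = D.the_inv_comp_h[unfolded h]
  \<comment> \<open>The two maps are known to agree only on \<open>Gset\<close>, which is the whole
    space of \<open>Q\<close>.\<close>
  have "distr Q G_space (the_inv_into Gset (\<lambda>g. h \<circ> g)) = distr Q G_space (\<lambda>g. D.hinv \<circ> g)"
    by (intro distr_cong) (simp_all add: spQ inv)
  then have "distr Q G_space (the_inv_into Gset (\<lambda>g. h \<circ> g)) = density Q (\<lambda>g. ennreal (Yb \<beta> h g))"
    using D.distr_comp_hinv[OF assms(7) refl] by (rule trans)
  moreover have "the_inv_into Gset (\<lambda>g. h \<circ> g) \<in> G_space \<rightarrow>\<^sub>M G_space"
    using measurable_cong[of G_space "the_inv_into Gset (\<lambda>g. h \<circ> g)" "\<lambda>g. D.hinv \<circ> g"]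
      D.comp_hinv_measurable inv by simp
  ultimately show ?thesis
    by (intro conjI D.bij_comp_h[unfolded h] D.Yb_measurable[OF refl] D.Yb_bounds[OF refl])
qed

end
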